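(* Let $f\in\mathbb{C}[h]$ with $\deg f>1$. If $\delta$ is a locally finite derivation of $\mathcal{H}(f)$, then there is $\lambda\in\mathbb{C}$ such that $\delta(x)=\lambda x$, $\delta(y)=-\lambda y$ and $\delta(h)=0$.
   Context: For a polynomial $f\in\mathbb{C}[h]$, the generalized Heisenberg algebra $\mathcal{H}(f)$ is the unital associative $\mathbb{C}$-algebra with generators $x,y,h$ and defining relations $$hx=xf(h),\qquad yh=f(h)y,\qquad yx-xy=f(h)-h.$$ Here $\deg f$ is the degree of $f$ as a polynomial in $h$. A derivation of $\mathcal{H}(f)$ is a $\mathbb{C}$-linear endomorphism $\delta$ of $\mathcal{H}(f)$ with $\delta(ab)=\delta(a)b+a\delta(b)$ for all $a,b\in\mathcal{H}(f)$. It is locally finite if for every $a\in\mathcal{H}(f)$ the $\mathbb{C}$-linear span of $\{\delta^k(a)\mid k\in\mathbb{Z}_{\geq 0}\}$ is finite dimensional. *)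

theory Defs
  imports "Jordan_Normal_Form.VS_Connect" "HOL-Library.Poly_Mapping" "HOL-Algebra.QuotRing"
begin

datatype 'g free_monoid = FM (letters: "'g list")

text \<open>The monoid of words is written additively (although it is not commutative), because
  the convolution product of \<^typ>\<open>'a \<Rightarrow>\<^sub>0 'b\<close> expects an additive monoid of exponents.\<close>

instantiation free_monoid :: (type) monoid_add
begin

definition zero_free_monoid :: "'g free_monoid" where
  "zero_free_monoid = FM []"

definition plus_free_monoid :: "'g free_monoid \<Rightarrow> 'g free_monoid \<Rightarrow> 'g free_monoid" where
  "plus_free_monoid u v = FM (letters u @ letters v)"

instance
  by standard (auto simp: zero_free_monoid_def plus_free_monoid_def)

end

text \<open>The free unital associative complex algebra on \<open>'g\<close> is the monoid algebra of the
  words over \<open>'g\<close>; \<^term>\<open>Poly_Mapping.single 0 c\<close> is the constant \<open>c\<close> (the empty word with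
  coefficient \<open>c\<close>).\<close>

type_synonym 'g free_alg = "'g free_monoid \<Rightarrow>\<^sub>0 complex"

definition free_algebra :: "(complex, 'g free_alg) module" where
  "free_algebra = \<lparr>carrier = UNIV, mult = (*), one = 1, zero = 0, add = (+),
     smult = (\<lambda>c p. Poly_Mapping.single 0 c * p)\<rparr>"

definition free_gen :: "'g \<Rightarrow> 'g free_alg" where
  "free_gen g = Poly_Mapping.single (FM [g]) 1"

definition quotient_algebra :: "('k, 'a) module \<Rightarrow> 'a set \<Rightarrow> ('k, 'a set) module" where
  "quotient_algebra A I =
    \<lparr>carrier = carrier (A Quot I), mult = mult (A Quot I), one = one (A Quot I),
     zero = zero (A Quot I), add = add (A Quot I),
     smult = (\<lambda>c X. \<Union>a\<in>X. I +>\<^bsub>A\<^esub> (c \<odot>\<^bsub>A\<^esub> a))\<rparr>"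

datatype heis_gen = GX | GY | GH

text \<open>\<open>f(h)\<close> in the free algebra; \<^const>\<open>poly\<close> is not applicable as it needs a commutative ring.\<close>

definition poly_in_h :: "complex poly \<Rightarrow> heis_gen free_alg" where
  "poly_in_h f = (\<Sum>i\<le>degree f. Poly_Mapping.single 0 (coeff f i) * free_gen GH ^ i)"

definition heis_relators :: "complex poly \<Rightarrow> heis_gen free_alg set" where
  "heis_relators f = (let x = free_gen GX; y = free_gen GY; h = free_gen GH in
    {h * x - x * poly_in_h f,
     y * h - poly_in_h f * y,
     (y * x - x * y) - (poly_in_h f - h)})"

definition heis_ideal :: "complex poly \<Rightarrow> heis_gen free_alg set" where
  "heis_ideal f = Idl\<^bsub>free_algebra\<^esub> (heis_relators f)"

definition gen_heisenberg :: "complex poly \<Rightarrow> (complex, heis_gen free_alg set) module" where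
  "gen_heisenberg f = quotient_algebra free_algebra (heis_ideal f)"

definition heis_x :: "complex poly \<Rightarrow> heis_gen free_alg set" where
  "heis_x f = heis_ideal f +>\<^bsub>free_algebra\<^esub> free_gen GX"

definition heis_y :: "complex poly \<Rightarrow> heis_gen free_alg set" where
  "heis_y f = heis_ideal f +>\<^bsub>free_algebra\<^esub> free_gen GY"

definition heis_h :: "complex poly \<Rightarrow> heis_gen free_alg set" where
  "heis_h f = heis_ideal f +>\<^bsub>free_algebra\<^esub> free_gen GH"

definition derivation :: "(complex, 'a) module \<Rightarrow> ('a \<Rightarrow> 'a) \<Rightarrow> bool" where
  "derivation A \<delta> \<longleftrightarrow> \<delta> \<in> LinearCombinations.module_hom class_ring A A \<and>
    (\<forall>a\<in>carrier A. \<forall>b\<in>carrier A. \<delta> (a \<otimes>\<^bsub>A\<^esub> b) = \<delta> a \<otimes>\<^bsub>A\<^esub> b \<oplus>\<^bsub>A\<^esub> a \<otimes>\<^bsub>A\<^esub> \<delta> b)"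

definition locally_finite :: "(complex, 'a) module \<Rightarrow> ('a \<Rightarrow> 'a) \<Rightarrow> bool" where
  "locally_finite A \<delta> \<longleftrightarrow> (\<forall>a\<in>carrier A.
     vectorspace.fin_dim class_ring
       (A\<lparr>carrier := LinearCombinations.module.span class_ring A {(\<delta> ^^ k) a |k. True}\<rparr>))"

text \<open>Well-formedness: \<^const>\<open>genideal\<close>, \<open>span\<close> and \<open>fin_dim\<close> have their intended meaning only
  over a ring and a vector space, respectively.\<close>

lemma ring_free_algebra: "ring free_algebra"
proof (rule ringI)
  have inv: "\<exists>z. x + z = 0" for x :: "'a free_alg"
    by (rule exI[of _ "- x"]) simp
  show "abelian_group (free_algebra :: (complex, 'a free_alg) module)"
    by (rule abelian_groupI) (simp_all add: free_algebra_def add_ac inv)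
  show "Group.monoid (free_algebra :: (complex, 'a free_alg) module)"
    by (rule monoidI) (simp_all add: free_algebra_def mult.assoc)
qed (simp_all add: free_algebra_def distrib_left distrib_right)

lemma ideal_heis_ideal: "ideal (heis_ideal f) free_algebra"
  unfolding heis_ideal_def
  by (rule ring.genideal_ideal[OF ring_free_algebra]) (simp add: free_algebra_def)

lemma single_0_mult: "Poly_Mapping.single 0 (c * d) =
    (Poly_Mapping.single 0 c * Poly_Mapping.single 0 d :: 'g free_alg)"
  by (simp add: mult_single)

lemma quotient_algebra_smult:
  fixes I :: "'g free_alg set"
  assumes "ideal I free_algebra"
  shows "c \<odot>\<^bsub>quotient_algebra free_algebra I\<^esub> (I +>\<^bsub>free_algebra\<^esub> a) =
    I +>\<^bsub>free_algebra\<^esub> (Poly_Mapping.single 0 c * a)"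
proof -
  interpret I: ideal I free_algebra by fact
  have eq: "I +>\<^bsub>free_algebra\<^esub> (Poly_Mapping.single 0 c * b) =
      I +>\<^bsub>free_algebra\<^esub> (Poly_Mapping.single 0 c * a)"
    if "b \<in> I +>\<^bsub>free_algebra\<^esub> a" for b
  proof -
    from that obtain i where i: "i \<in> I" "b = i + a"
      by (auto simp: a_r_coset_def' free_algebra_def)
    have "Poly_Mapping.single 0 c * i \<in> I"
      using I.I_l_closed[OF i(1), of "Poly_Mapping.single 0 c"] by (simp add: free_algebra_def)
    then have "Poly_Mapping.single 0 c * b \<in> I +>\<^bsub>free_algebra\<^esub> (Poly_Mapping.single 0 c * a)"
      using i by (auto simp: a_r_coset_def' free_algebra_def distrib_left)
    then show ?thesis
      by (rule I.a_repr_independence'[symmetric]) (simp add: free_algebra_def)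
  qed
  have "a \<in> I +>\<^bsub>free_algebra\<^esub> a"
    by (rule I.a_rcos_self) (simp add: free_algebra_def)
  with eq have "(\<Union>b\<in>I +>\<^bsub>free_algebra\<^esub> a. I +>\<^bsub>free_algebra\<^esub> (Poly_Mapping.single 0 c * b)) =
      I +>\<^bsub>free_algebra\<^esub> (Poly_Mapping.single 0 c * a)"
    by blast
  then show ?thesis
    by (simp add: quotient_algebra_def free_algebra_def)
qed

lemma
  fixes I :: "'g free_alg set"
  assumes I: "ideal I free_algebra"
  shows ring_quotient_algebra: "ring (quotient_algebra free_algebra I)"
    and vectorspace_quotient_algebra: "vectorspace class_ring (quotient_algebra free_algebra I)"
proof -
  interpret I: ideal I free_algebra by fact
  let ?F = "free_algebra :: (complex, 'g free_alg) module"
  let ?Q = "quotient_algebra ?F I"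
  have Q: "ring (?F Quot I)" by (rule I.quotient_is_ring)
  interpret Q: ring "?F Quot I" by fact
  have ab: "abelian_group ?Q"
    by (rule abelian_groupI)
      (use Q.a_assoc Q.a_comm Q.l_zero Q.add.l_inv_ex in \<open>auto simp: quotient_algebra_def\<close>)
  show "ring ?Q"
    by (rule ringI[OF ab monoidI])
      (use Q.m_assoc Q.l_distr Q.r_distr in \<open>auto simp: quotient_algebra_def\<close>)
  have carr: "\<exists>a. X = I +>\<^bsub>?F\<^esub> a" if "X \<in> carrier ?Q" for X
    using that by (auto simp: quotient_algebra_def FactRing_simps)
  have in_carr: "I +>\<^bsub>?F\<^esub> a \<in> carrier ?Q" for a
    using ring_hom_closed[OF I.rcos_ring_hom, of a]
    by (simp add: quotient_algebra_def) (simp add: free_algebra_def)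
  have add: "(I +>\<^bsub>?F\<^esub> a) \<oplus>\<^bsub>?Q\<^esub> (I +>\<^bsub>?F\<^esub> b) = I +>\<^bsub>?F\<^esub> (a + b)" for a b
    using I.a_rcos_sum[of a b] by (simp add: quotient_algebra_def FactRing_def free_algebra_def)
  note smult = quotient_algebra_smult[OF I]
  have "module class_ring ?Q"
  proof (rule moduleI[OF class_cring.cring_axioms ab])
    fix c X assume "X \<in> carrier ?Q"
    then obtain a where "X = I +>\<^bsub>?F\<^esub> a" using carr by blast
    then show "c \<odot>\<^bsub>?Q\<^esub> X \<in> carrier ?Q" by (simp add: smult in_carr)
  next
    fix c d X assume "X \<in> carrier ?Q"
    then obtain a where "X = I +>\<^bsub>?F\<^esub> a" using carr by blast
    then show "(c \<oplus>\<^bsub>class_ring\<^esub> d) \<odot>\<^bsub>?Q\<^esub> X = c \<odot>\<^bsub>?Q\<^esub> X \<oplus>\<^bsub>?Q\<^esub> d \<odot>\<^bsub>?Q\<^esub> X"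
      by (simp add: smult add single_add distrib_right)
  next
    fix c X Y assume "X \<in> carrier ?Q" "Y \<in> carrier ?Q"
    then obtain a b where "X = I +>\<^bsub>?F\<^esub> a" "Y = I +>\<^bsub>?F\<^esub> b" using carr by blast
    then show "c \<odot>\<^bsub>?Q\<^esub> (X \<oplus>\<^bsub>?Q\<^esub> Y) = c \<odot>\<^bsub>?Q\<^esub> X \<oplus>\<^bsub>?Q\<^esub> c \<odot>\<^bsub>?Q\<^esub> Y"
      by (simp add: smult add distrib_left)
  next
    fix c d X assume "X \<in> carrier ?Q"
    then obtain a where "X = I +>\<^bsub>?F\<^esub> a" using carr by blast
    then show "(c \<otimes>\<^bsub>class_ring\<^esub> d) \<odot>\<^bsub>?Q\<^esub> X = c \<odot>\<^bsub>?Q\<^esub> (d \<odot>\<^bsub>?Q\<^esub> X)"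
      by (simp add: smult single_0_mult mult.assoc)
  next
    fix X assume "X \<in> carrier ?Q"
    then obtain a where "X = I +>\<^bsub>?F\<^esub> a" using carr by blast
    then show "\<one>\<^bsub>class_ring\<^esub> \<odot>\<^bsub>?Q\<^esub> X = X" by (simp add: smult)
  qed
  then show "vectorspace class_ring ?Q"
    by (rule vectorspace.intro) (rule class_field)
qed

lemma ring_gen_heisenberg: "ring (gen_heisenberg f)"
  unfolding gen_heisenberg_def by (rule ring_quotient_algebra[OF ideal_heis_ideal])

lemma vectorspace_gen_heisenberg: "vectorspace class_ring (gen_heisenberg f)"
  unfolding gen_heisenberg_def by (rule vectorspace_quotient_algebra[OF ideal_heis_ideal])

end

theory Submission
  imports Defs "HOL-Computational_Algebra.Fundamental_Theorem_Algebra"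
begin

text \<open>
  Write \<open>H\<close> for the algebra. It is a domain, and this already forces \<open>\<delta> h = 0\<close>: decompose \<open>H\<close>
  into the generalized eigenspaces of \<open>\<delta>\<close>, which are multiplied by adding eigenvalues. Comparing
  the top components in \<open>h x = x f(h)\<close>, where \<open>f(h)\<close> has the leading behaviour of \<open>h\<^sup>d\<close> with
  \<open>d > 1\<close>, shows that \<open>0\<close> is the only eigenvalue on \<open>h\<close>, and comparing nilpotency orders then
  shows that \<open>\<delta>\<close> kills \<open>h\<close>.

  Consequently \<open>\<delta> x\<close> and \<open>\<delta> y\<close> satisfy the same commutation relations with \<open>h\<close> as \<open>x\<close> and \<open>y\<close>.
  In the representation of \<open>H\<close> on \<open>H / H y\<close>, which has the basis \<open>1, x, x\<^sup>2, \<dots>\<close> over \<open>\<complex>[h]\<close>, they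
  shift this basis by one, and \<open>y x - x y = f(h) - h\<close> gives \<open>\<delta> (x y) = 0\<close>. It follows that \<open>\<delta>\<close>
  kills every \<open>x\<^sup>k p(h) y\<^sup>k\<close>. As \<open>\<delta> x = x a\<close> with \<open>a\<close> a sum of such words, \<open>\<delta>\<^sup>k x = x a\<^sup>k\<close>;
  local finiteness makes \<open>a\<close> algebraic over \<open>\<complex>\<close>, hence a scalar.

  That \<open>H\<close> is a domain with basis \<open>x\<^sup>i h\<^sup>j y\<^sup>k\<close> is read off the same representation: a nonzero
  combination of these words shifts the degree of all basis vectors \<open>x\<^sup>n\<close> with \<open>n\<close> large by the same
  amount.
\<close>

section \<open>Polynomials over central scalars\<close>

text \<open>The scalars enter through a central ring homomorphism \<open>sc\<close>, so that the
  free algebra and the endomorphisms of a module share one calculus of polynomials and normal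
  forms.\<close>

locale central_scalars =
  fixes sc :: "complex \<Rightarrow> 'r::ring_1"
  assumes sc_1 [simp]: "sc 1 = 1"
    and sc_add: "sc (c + d) = sc c + sc d"
    and sc_mult: "sc (c * d) = sc c * sc d"
    and sc_comm: "sc c * a = a * sc c"
begin

lemma sc_0 [simp]: "sc 0 = 0"
  using sc_add[of 0 0] by simp

lemma sc_minus: "sc (- c) = - sc c"
  using sc_add[of c "- c"] by (simp add: eq_neg_iff_add_eq_0 add.commute)

lemma sc_diff: "sc (c - d) = sc c - sc d"
  using sc_add[of c "- d"] by (simp add: sc_minus)

lemma sc_left_comm: "a * (sc c * b) = sc c * (a * b)"
  by (metis mult.assoc sc_comm)

lemma sc_sc_comm: "sc c * (sc d * a) = sc d * (sc c * a)"
  by (rule sc_left_comm)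

lemma sc_inverse_cancel: "c \<noteq> 0 \<Longrightarrow> sc (inverse c) * (sc c * a) = a"
  by (simp flip: mult.assoc sc_mult)

lemma sc_cancel: "c \<noteq> 0 \<Longrightarrow> sc c * a = sc c * b \<longleftrightarrow> a = b"
  by (metis sc_inverse_cancel)

lemma sc_eq_0_iff: "c \<noteq> 0 \<Longrightarrow> sc c * a = 0 \<longleftrightarrow> a = 0"
  using sc_cancel[of c a 0] by simp

definition peval :: "complex poly \<Rightarrow> 'r \<Rightarrow> 'r" where
  "peval p a = (\<Sum>i\<le>degree p. sc (coeff p i) * a ^ i)"

lemma peval_bound:
  assumes "degree p \<le> n"
  shows "peval p a = (\<Sum>i\<le>n. sc (coeff p i) * a ^ i)"
  unfolding peval_def using assms
  by (intro sum.mono_neutral_left) (auto simp: coeff_eq_0)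

lemma peval_0 [simp]: "peval 0 a = 0"
  by (simp add: peval_def)

lemma peval_pCons: "peval (pCons c p) a = sc c + a * peval p a"
proof -
  have "peval (pCons c p) a = (\<Sum>i\<le>Suc (degree p). sc (coeff (pCons c p) i) * a ^ i)"
    by (rule peval_bound) (simp add: degree_pCons_le)
  also have "\<dots> = sc c + a * peval p a"
    by (subst sum.atMost_Suc_shift) (simp add: peval_def sum_distrib_left sc_left_comm)
  finally show ?thesis .
qed

lemma peval_1 [simp]: "peval 1 a = 1"
  by (simp add: peval_pCons one_pCons)

lemma peval_X [simp]: "peval [:0, 1:] a = a"
  by (simp add: peval_pCons)

lemma peval_add: "peval (p + q) a = peval p a + peval q a"
proof -
  define n where "n = max (degree p) (degree q)"
  have "degree (p + q) \<le> n" "degree p \<le> n" "degree q \<le> n"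
    by (auto simp: n_def degree_add_le_max)
  then show ?thesis
    by (simp add: peval_bound sc_add distrib_right sum.distrib)
qed

lemma peval_smult: "peval (Polynomial.smult c p) a = sc c * peval p a"
  by (induction p) (simp_all add: peval_pCons sc_mult distrib_left sc_left_comm)

lemma peval_minus: "peval (- p) a = - peval p a"
  using peval_smult[of "-1" p a] by (simp add: sc_minus)

lemma peval_diff: "peval (p - q) a = peval p a - peval q a"
  using peval_add[of p "- q"] by (simp add: peval_minus)

lemma peval_mult: "peval (p * q) a = peval p a * peval q a"
  by (induction p) (simp_all add: peval_pCons peval_add peval_smult distrib_right mult.assoc)

lemma peval_pcompose: "peval (p \<circ>\<^sub>p q) a = peval p (peval q a)"
  by (induction p) (simp_all add: pcompose_pCons peval_pCons peval_add peval_mult)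

text \<open>Moving \<open>b\<close> to the left turns \<open>a\<close> into \<open>c\<close>, one
  power at a time. Membership in a set closed like a two-sided ideal replaces equality because the
  relations hold in the free algebra only modulo an ideal.\<close>

lemma peval_intertwine_mod:
  assumes I: "0 \<in> I" "\<And>u v. u \<in> I \<Longrightarrow> v \<in> I \<Longrightarrow> u + v \<in> I"
    "\<And>u v. u \<in> I \<Longrightarrow> v * u \<in> I" "\<And>u v. u \<in> I \<Longrightarrow> u * v \<in> I"
    and ab: "a * b - b * c \<in> I"
  shows "peval p a * b - b * peval p c \<in> I"
proof (induction p)
  case 0
  then show ?case by (simp add: I)
next
  case (pCons e p)
  have "peval (pCons e p) a * b - b * peval (pCons e p) c =
      a * (peval p a * b - b * peval p c) + (a * b - b * c) * peval p c"
    by (simp add: peval_pCons algebra_simps sc_comm)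
  also have "\<dots> \<in> I"
    by (intro I pCons.IH ab)
  finally show ?case .
qed

end

locale subalgebra = central_scalars sc
  for sc :: "complex \<Rightarrow> 'r::ring_1" +
  fixes S :: "'r set"
  assumes S_sc [simp]: "sc c \<in> S"
    and S_add [simp]: "a \<in> S \<Longrightarrow> b \<in> S \<Longrightarrow> a + b \<in> S"
    and S_mult [simp]: "a \<in> S \<Longrightarrow> b \<in> S \<Longrightarrow> a * b \<in> S"
begin

lemma S_0 [simp]: "0 \<in> S"
  using S_sc[of 0] by simp

lemma S_1 [simp]: "1 \<in> S"
  using S_sc[of 1] by simp

lemma S_minus [simp]: "a \<in> S \<Longrightarrow> - a \<in> S"
  using S_mult[OF S_sc[of "-1"]] by (simp add: sc_minus)

lemma S_diff [simp]: "a \<in> S \<Longrightarrow> b \<in> S \<Longrightarrow> a - b \<in> S"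
  using S_add[of a "- b"] by simp

lemma S_power [simp]: "a \<in> S \<Longrightarrow> a ^ n \<in> S"
  by (induction n) auto

lemma S_sum: "(\<And>i. i \<in> A \<Longrightarrow> g i \<in> S) \<Longrightarrow> sum g A \<in> S"
  by (induction A rule: infinite_finite_induct) auto

lemma S_peval [simp]: "a \<in> S \<Longrightarrow> peval p a \<in> S"
  by (auto simp: peval_def intro!: S_sum)

text \<open>Over \<complex> the polynomial splits, and its roots are stripped off one by one. The
  list of roots, repetitions included, is the form in which local finiteness is used
  afterwards.\<close>

lemma poly_annihilated_factor:
  assumes S: "\<And>a. a \<in> S \<Longrightarrow> \<delta> a \<in> S"
    and add: "\<And>a b. a \<in> S \<Longrightarrow> b \<in> S \<Longrightarrow> \<delta> (a + b) = \<delta> a + \<delta> b"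
    and scale: "\<And>c a. a \<in> S \<Longrightarrow> \<delta> (sc c * a) = sc c * \<delta> a"
    and "a \<in> S" "P \<noteq> 0" "(\<Sum>i\<le>degree P. sc (coeff P i) * (\<delta> ^^ i) a) = 0"
  shows "\<exists>ls. fold (\<lambda>l b. \<delta> b - sc l * b) ls a = 0"
proof -
  define pd where "pd P a = (\<Sum>i\<le>degree P. sc (coeff P i) * (\<delta> ^^ i) a)" for P a
  have pow_S: "(\<delta> ^^ i) a \<in> S" if "a \<in> S" for i a
    using that by (induction i) (simp_all add: S)
  have pow_add: "(\<delta> ^^ i) (a + b) = (\<delta> ^^ i) a + (\<delta> ^^ i) b" if "a \<in> S" "b \<in> S" for i a b
    using that by (induction i) (simp_all add: add pow_S)
  have pow_scale: "(\<delta> ^^ i) (sc c * a) = sc c * (\<delta> ^^ i) a" if "a \<in> S" for i c a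
    using that by (induction i) (simp_all add: scale pow_S)
  have bound: "pd P a = (\<Sum>i\<le>n. sc (coeff P i) * (\<delta> ^^ i) a)" if "degree P \<le> n" for P n a
    unfolding pd_def using that by (intro sum.mono_neutral_left) (auto simp: coeff_eq_0)
  \<comment> \<open>Here \<open>pd P a\<close> is P(\<delta>) applied to \<open>a\<close>; removing
    a linear factor from the polynomial costs one application of \<delta> - l to the
    argument.\<close>
  have pd_factor: "pd ([:- l, 1:] * Q) a = pd Q (\<delta> a - sc l * a)" if a: "a \<in> S" for l Q a
  proof -
    let ?n = "degree Q"
    have "degree ([:- l, 1:] * Q) \<le> Suc ?n"
      by (rule order_trans[OF degree_mult_le]) simp
    then have "pd ([:- l, 1:] * Q) a =
        (\<Sum>i\<le>Suc ?n. sc (coeff (pCons 0 Q) i) * (\<delta> ^^ i) a) - (\<Sum>i\<le>Suc ?n. sc (l * coeff Q i) * (\<delta> ^^ i) a)"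
      by (simp add: bound[of _ "Suc ?n"] sc_diff left_diff_distrib sum_subtractf del: sum.atMost_Suc)
    also have "(\<Sum>i\<le>Suc ?n. sc (coeff (pCons 0 Q) i) * (\<delta> ^^ i) a) = pd Q (\<delta> a)"
      by (subst sum.atMost_Suc_shift) (simp add: pd_def funpow_swap1)
    also have "(\<Sum>i\<le>Suc ?n. sc (l * coeff Q i) * (\<delta> ^^ i) a) = (\<Sum>i\<le>?n. sc (coeff Q i) * (\<delta> ^^ i) (sc l * a))"
      using a by (simp add: pow_scale coeff_eq_0 sc_mult sc_sc_comm mult.assoc)
    also have "pd Q (\<delta> a) - \<dots> = pd Q (\<delta> a - sc l * a)"
      using a pow_add[of "\<delta> a - sc l * a" "sc l * a"] S
      by (simp add: pd_def algebra_simps flip: sum_subtractf)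
    finally show ?thesis .
  qed
  have "pd P a = 0"
    using assms(6) by (simp add: pd_def)
  with \<open>a \<in> S\<close> \<open>P \<noteq> 0\<close> show ?thesis
  proof (induction "degree P" arbitrary: P a)
    case 0
    then obtain c where "P = [:c:]" by (metis degree_eq_zeroE)
    with "0.prems" have "a = 0"
      using sc_eq_0_iff[of c a] by (simp add: pd_def)
    then show ?case by (intro exI[of _ "[]"]) simp
  next
    case (Suc n)
    have "\<not> constant (poly P)"
      using Suc.hyps(2) by (simp add: constant_degree)
    then obtain l where "poly P l = 0"
      using fundamental_theorem_of_algebra by blast
    then obtain Q where Q: "P = [:- l, 1:] * Q"
      using poly_eq_0_iff_dvd by (metis dvdE)
    have "Q \<noteq> 0" using Q Suc.prems by auto
    have deg: "degree P = Suc (degree Q)"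
      unfolding Q using \<open>Q \<noteq> 0\<close> by (subst degree_mult_eq) auto
    have "pd Q (\<delta> a - sc l * a) = 0"
      using Suc.prems(3) pd_factor[OF Suc.prems(1), of l Q, folded Q] by simp
    moreover have "\<delta> a - sc l * a \<in> S" "n = degree Q"
      using Suc.prems(1) Suc.hyps(2) deg S by simp_all
    ultimately have "\<exists>ls. fold (\<lambda>l b. \<delta> b - sc l * b) ls (\<delta> a - sc l * a) = 0"
      using \<open>Q \<noteq> 0\<close> Suc.hyps(1)[of Q] by blast
    then obtain ls where "fold (\<lambda>l b. \<delta> b - sc l * b) ls (\<delta> a - sc l * a) = 0" ..
    then show ?case
      by (intro exI[of _ "l # ls"]) simp
  qed
qed

end

section \<open>Locally finite derivations of domains\<close>

text \<open>The domain is a subset \<open>S\<close> of a ring because the algebra will appear as the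
  range of a representation.\<close>

locale domain_lf_derivation = subalgebra sc S
  for sc :: "complex \<Rightarrow> 'r::ring_1" and S +
  fixes \<delta> :: "'r \<Rightarrow> 'r"
  assumes no_zero_div: "a \<in> S \<Longrightarrow> b \<in> S \<Longrightarrow> a * b = 0 \<Longrightarrow> a = 0 \<or> b = 0"
    and \<delta>_S [simp]: "a \<in> S \<Longrightarrow> \<delta> a \<in> S"
    and \<delta>_add: "a \<in> S \<Longrightarrow> b \<in> S \<Longrightarrow> \<delta> (a + b) = \<delta> a + \<delta> b"
    and \<delta>_mult: "a \<in> S \<Longrightarrow> b \<in> S \<Longrightarrow> \<delta> (a * b) = \<delta> a * b + a * \<delta> b"
    and \<delta>_scale: "a \<in> S \<Longrightarrow> \<delta> (sc c * a) = sc c * \<delta> a"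
    and loc_fin: "a \<in> S \<Longrightarrow> \<exists>ls. fold (\<lambda>l b. \<delta> b - sc l * b) ls a = 0"
begin

lemma \<delta>_0 [simp]: "\<delta> 0 = 0"
  using \<delta>_add[of 0 0] by simp

lemma \<delta>_1 [simp]: "\<delta> 1 = 0"
  using \<delta>_mult[of 1 1] by simp

lemma \<delta>_sc [simp]: "\<delta> (sc c) = 0"
  using \<delta>_scale[of 1 c] by simp

lemma \<delta>_minus: "a \<in> S \<Longrightarrow> \<delta> (- a) = - \<delta> a"
  using \<delta>_scale[of a "-1"] by (simp add: sc_minus)

lemma \<delta>_diff: "a \<in> S \<Longrightarrow> b \<in> S \<Longrightarrow> \<delta> (a - b) = \<delta> a - \<delta> b"
  using \<delta>_add[of a "- b"] by (simp add: \<delta>_minus)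

lemma \<delta>_sum:
  "(\<And>i. i \<in> A \<Longrightarrow> g i \<in> S) \<Longrightarrow> \<delta> (sum g A) = (\<Sum>i\<in>A. \<delta> (g i))"
  by (induction A rule: infinite_finite_induct) (auto simp: \<delta>_add S_sum)

lemma \<delta>_peval_0:
  assumes "a \<in> S" "\<delta> a = 0"
  shows "\<delta> (peval p a) = 0"
  by (induction p) (auto simp: peval_pCons \<delta>_add \<delta>_mult assms)

section \<open>Generalized eigenspaces of the derivation\<close>

definition dl :: "complex \<Rightarrow> 'r \<Rightarrow> 'r" where
  "dl l b = \<delta> b - sc l * b"

lemma dl_S [simp]: "a \<in> S \<Longrightarrow> dl l a \<in> S"
  by (auto simp: dl_def)

lemma dl_0 [simp]: "dl l 0 = 0"
  by (simp add: dl_def)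

lemma dl_add: "a \<in> S \<Longrightarrow> b \<in> S \<Longrightarrow> dl l (a + b) = dl l a + dl l b"
  by (simp add: dl_def \<delta>_add distrib_left)

lemma dl_scale: "a \<in> S \<Longrightarrow> dl l (sc c * a) = sc c * dl l a"
  by (simp add: dl_def \<delta>_scale right_diff_distrib sc_sc_comm)

lemma dl_commute: "a \<in> S \<Longrightarrow> dl l (dl m a) = dl m (dl l a)"
  by (simp add: dl_def \<delta>_diff \<delta>_scale right_diff_distrib sc_sc_comm)

text \<open>This shifted Leibniz rule is the reason why eigenvalues add under
  multiplication.\<close>

lemma dl_mult:
  assumes "a \<in> S" "b \<in> S"
  shows "dl (l + m) (a * b) = dl l a * b + a * dl m b"
  using assms by (simp add: dl_def \<delta>_mult sc_add algebra_simps) (metis sc_left_comm)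

lemma dl_shift: "dl l a = dl m a + sc (m - l) * a"
  by (simp add: dl_def sc_diff algebra_simps)

abbreviation dls :: "complex list \<Rightarrow> 'r \<Rightarrow> 'r" where
  "dls ls \<equiv> fold dl ls"

lemma dls_S [simp]: "a \<in> S \<Longrightarrow> dls ls a \<in> S"
  by (induction ls arbitrary: a) auto

lemma dls_0 [simp]: "dls ls 0 = 0"
  by (induction ls) auto

lemma dls_add: "a \<in> S \<Longrightarrow> b \<in> S \<Longrightarrow> dls ls (a + b) = dls ls a + dls ls b"
  by (induction ls arbitrary: a b) (auto simp: dl_add)

lemma dls_scale: "a \<in> S \<Longrightarrow> dls ls (sc c * a) = sc c * dls ls a"
  by (induction ls arbitrary: a) (auto simp: dl_scale)

lemma dls_dl: "a \<in> S \<Longrightarrow> dls ls (dl l a) = dl l (dls ls a)"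
proof (induction ls arbitrary: a)
  case (Cons m ls)
  then show ?case
    using dl_commute[of a m l] by simp
qed simp

lemma dls_dls: "a \<in> S \<Longrightarrow> dls ls (dls ms a) = dls ms (dls ls a)"
  by (induction ms arbitrary: a) (auto simp: dls_dl)

text \<open>The sum of the generalized eigenspaces of \<open>\<delta>\<close> for the eigenvalues in \<open>A\<close>.\<close>

definition geig :: "complex set \<Rightarrow> 'r set" where
  "geig A = {a \<in> S. \<exists>ls. set ls \<subseteq> A \<and> dls ls a = 0}"

lemma geigI: "a \<in> S \<Longrightarrow> set ls \<subseteq> A \<Longrightarrow> dls ls a = 0 \<Longrightarrow> a \<in> geig A"
  unfolding geig_def by blast

lemma geigE:
  assumes "a \<in> geig A"
  obtains ls where "a \<in> S" "set ls \<subseteq> A" "dls ls a = 0"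
  using assms unfolding geig_def by blast

lemma geig_S: "a \<in> geig A \<Longrightarrow> a \<in> S"
  by (rule geigE)

lemma geig_mono: "a \<in> geig A \<Longrightarrow> A \<subseteq> B \<Longrightarrow> a \<in> geig B"
  by (meson geigE geigI order_trans)

lemma geig_0 [simp]: "0 \<in> geig A"
  by (rule geigI[of _ "[]"]) auto

lemma geig_empty: "a \<in> geig {} \<Longrightarrow> a = 0"
  by (erule geigE) simp

lemma geig_dlI:
  assumes "a \<in> S" "l \<in> A" "dl l a \<in> geig A"
  shows "a \<in> geig A"
proof -
  obtain ls where "set ls \<subseteq> A" "dls ls (dl l a) = 0"
    using assms(3) by (rule geigE)
  then show ?thesis
    using assms by (intro geigI[of _ "l # ls"]) auto
qed

lemma geig_dl: "a \<in> geig A \<Longrightarrow> dl l a \<in> geig A"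
  by (erule geigE, rule geigI) (auto simp: dls_dl)

lemma geig_finite:
  assumes "a \<in> S"
  obtains A where "finite A" "a \<in> geig A"
proof -
  obtain ls where "fold (\<lambda>l b. \<delta> b - sc l * b) ls a = 0"
    using loc_fin[OF assms] by blast
  moreover have "(\<lambda>l b. \<delta> b - sc l * b) = dl"
    by (intro ext) (simp add: dl_def)
  ultimately have "a \<in> geig (set ls)"
    using assms by (intro geigI[of _ ls]) auto
  with that show ?thesis
    by blast
qed

lemma geig_add: 
  assumes "a \<in> geig A" "b \<in> geig A"
  shows "a + b \<in> geig A"
proof -
  obtain ls ms where "set ls \<subseteq> A" "dls ls a = 0" "set ms \<subseteq> A" "dls ms b = 0"
    using assms by (meson geigE)
  moreover have "dls ms (dls ls b) = dls ls (dls ms b)"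
    using assms geig_S by (metis dls_dls)
  ultimately have "set (ls @ ms) \<subseteq> A" "dls (ls @ ms) (a + b) = 0"
    using assms[THEN geig_S] by (auto simp: dls_add)
  then show ?thesis
    using assms[THEN geig_S] by (intro geigI[of _ "ls @ ms"]) auto
qed

lemma geig_scale: "a \<in> geig A \<Longrightarrow> sc c * a \<in> geig A"
  by (erule geigE, rule geigI) (auto simp: dls_scale)

lemma geig_minus: "a \<in> geig A \<Longrightarrow> - a \<in> geig A"
  using geig_scale[of a A "-1"] by (simp add: sc_minus)

lemma geig_diff: "a \<in> geig A \<Longrightarrow> b \<in> geig A \<Longrightarrow> a - b \<in> geig A"
  using geig_add[of a A "- b"] by (simp add: geig_minus)

text \<open>Induction on the total length of the two annihilating lists: applying \<delta> - (l + m)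
  to the product yields two products in which one list has become shorter.\<close>

lemma geig_mult:
  assumes "a \<in> geig A" "b \<in> geig B" "\<And>l m. l \<in> A \<Longrightarrow> m \<in> B \<Longrightarrow> l + m \<in> C"
  shows "a * b \<in> geig C"
proof -
  obtain ls ms where "set ls \<subseteq> A" "dls ls a = 0" "set ms \<subseteq> B" "dls ms b = 0" "a \<in> S" "b \<in> S"
    using assms by (meson geigE)
  then show ?thesis
  proof (induction "length ls + length ms" arbitrary: ls ms a b rule: less_induct)
    case less
    show ?case
    proof (cases "ls = [] \<or> ms = []")
      case True
      then show ?thesis using less.prems by auto
    next
      case False
      then obtain l ls' m ms' where [simp]: "ls = l # ls'" "ms = m # ms'"
        by (meson neq_Nil_conv)
      have "dl l a * b \<in> geig C"
        by (rule less.hyps[of ls' ms]) (use less.prems in auto)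
      moreover have "a * dl m b \<in> geig C"
        by (rule less.hyps[of ls ms']) (use less.prems in auto)
      ultimately have "dl (l + m) (a * b) \<in> geig C"
        using less.prems by (simp add: dl_mult geig_add)
      moreover have "a * b \<in> S" "l + m \<in> C"
        using less.prems assms(3)[of l m] by simp_all
      ultimately show ?thesis
        by (blast intro: geig_dlI[of _ "l + m"])
    qed
  qed
qed

text \<open>By induction \<open>dl l a\<close> vanishes, so \<open>a\<close> is an eigenvector for
  \<open>l\<close>. Each \<open>dl m\<close> with m in \<open>B\<close> then acts on it as the
  nonzero scalar l - m, and a product of these kills \<open>a\<close>.\<close>

lemma geig_disjoint:
  assumes "a \<in> geig A" "a \<in> geig B" "A \<inter> B = {}"
  shows "a = 0"
proof -
  obtain ls where "set ls \<subseteq> A" "dls ls a = 0"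
    using assms by (meson geigE)
  then show ?thesis
    using assms(2)
  proof (induction ls arbitrary: a)
    case Nil
    then show ?case by simp
  next
    case (Cons l ls)
    have "dl l a = 0"
      by (rule Cons.IH) (use Cons.prems in \<open>simp_all add: geig_dl\<close>)
    then have eq: "dl m a = sc (l - m) * a" for m
      using dl_shift[of m a l] by simp
    obtain ms where "set ms \<subseteq> B" "dls ms a = 0"
      using Cons.prems by (meson geigE)
    moreover have "l \<notin> B"
      using Cons.prems assms(3) by auto
    moreover have "a \<in> S"
      using Cons.prems by (meson geig_S)
    ultimately show ?case
    proof (induction ms)
      case (Cons m ms)
      have "sc (l - m) * dls ms a = 0"
        using Cons.prems by (simp add: eq dls_scale)
      then have "dls ms a = 0"
        using Cons.prems by (metis list.set_intros(1) right_minus_eq sc_eq_0_iff subsetD)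
      with Cons.prems show ?case
        by (intro Cons.IH) simp_all
    qed simp
  qed
qed

lemma dl_surj:
  assumes "a \<in> geig B" "l \<notin> B"
  obtains b where "b \<in> geig B" "dl l b = a"
proof -
  obtain ms where "set ms \<subseteq> B" "dls ms a = 0" "a \<in> S"
    using assms by (meson geigE)
  then have "\<exists>b\<in>geig B. dl l b = a"
  proof (induction ms arbitrary: a)
    case Nil
    then show ?case by (auto intro!: bexI[of _ 0])
  next
    case (Cons m ms)
    have "\<exists>b\<in>geig B. dl l b = dl m a"
      by (rule Cons.IH) (use Cons.prems in simp_all)
    then obtain b where b: "b \<in> geig B" "dl l b = dl m a"
      by blast
    have "m \<noteq> l"
      using Cons.prems assms by auto
    \<comment> \<open>Since \<open>dl l b = dl m a\<close>, applying \<delta> - l to a - b leaves (m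
      - l) a, and \<open>m\<close> differs from \<open>l\<close>.\<close>
    define c where "c = sc (inverse (m - l)) * (a - b)"
    have a: "a \<in> geig B"
      using Cons.prems by (intro geigI[of _ "m # ms"]) auto
    have "dl l (a - b) = dl l a - dl l b"
      using dl_add[of "a - b" b l] geig_S[OF a] geig_S[OF b(1)] by simp
    also have "\<dots> = sc (m - l) * a"
      using b dl_shift[of l a m] by simp
    finally have "dl l c = a"
      unfolding c_def using geig_S[OF a] geig_S[OF b(1)] \<open>m \<noteq> l\<close>
      by (simp add: dl_scale sc_inverse_cancel)
    moreover have "c \<in> geig B"
      unfolding c_def using a b by (intro geig_scale geig_diff)
    ultimately show ?case by blast
  qed
  with that show ?thesis by blast
qed

text \<open>Primary decomposition. The part of \<open>dl l a\<close> whose eigenvalues exclude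
  \<open>l\<close> has a preimage \<open>d\<close> under \<delta> - l, and a - d then belongs
  entirely to the other part.\<close>

lemma geig_split:
  assumes "a \<in> geig C"
  obtains b c where "b \<in> geig (C \<inter> A)" "c \<in> geig (C - A)" "a = b + c"
proof -
  obtain ls where "set ls \<subseteq> C" "dls ls a = 0" "a \<in> S"
    using assms by (meson geigE)
  then have "\<exists>b\<in>geig (C \<inter> A). \<exists>c\<in>geig (C - A). a = b + c"
  proof (induction ls arbitrary: a)
    case Nil
    then show ?case
      by (auto intro!: bexI[of _ 0])
  next
    case (Cons l ls)
    have "\<exists>b\<in>geig (C \<inter> A). \<exists>c\<in>geig (C - A). dl l a = b + c"
      by (rule Cons.IH) (use Cons.prems in auto)
    then obtain b c where bc: "b \<in> geig (C \<inter> A)" "c \<in> geig (C - A)" "dl l a = b + c"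
      by blast
    have *: "a - d \<in> geig D" if d: "d \<in> S" and D: "dl l a - dl l d \<in> geig D" "l \<in> D" for d D
    proof (rule geig_dlI)
      show "dl l (a - d) \<in> geig D"
        using dl_add[of "a - d" d l] d D Cons.prems by simp
    qed (use d D Cons.prems in auto)
    show ?case
    proof (cases "l \<in> A")
      case True
      then obtain d where d: "d \<in> geig (C - A)" "dl l d = c"
        using dl_surj[OF bc(2), of l] by auto
      have "a - d \<in> geig (C \<inter> A)"
        by (rule *) (use True d bc Cons.prems in \<open>auto intro: geig_S\<close>)
      with d show ?thesis
        by (metis diff_add_cancel)
    next
      case False
      then obtain d where d: "d \<in> geig (C \<inter> A)" "dl l d = b"
        using dl_surj[OF bc(1), of l] by auto
      have "a - d \<in> geig (C - A)"
        by (rule *) (use False d bc Cons.prems in \<open>auto intro: geig_S\<close>)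
      with d show ?thesis
        by (metis add.commute diff_add_cancel)
    qed
  qed
  with that show ?thesis by blast
qed

lemma geig_Int:
  assumes "a \<in> geig A" "a \<in> geig B"
  shows "a \<in> geig (A \<inter> B)"
proof -
  obtain b c where bc: "b \<in> geig (A \<inter> B)" "c \<in> geig (A - B)" "a = b + c"
    using geig_split[OF assms(1), of B] by blast
  have "a - b \<in> geig B"
    using assms(2) geig_mono[OF bc(1)] by (intro geig_diff) auto
  then have "c = 0"
    using bc by (intro geig_disjoint[of c B "A - B"]) auto
  with bc show ?thesis by simp
qed

lemma S_mult_nonzero: "a \<in> S \<Longrightarrow> b \<in> S \<Longrightarrow> a \<noteq> 0 \<Longrightarrow> b \<noteq> 0 \<Longrightarrow> a * b \<noteq> 0"
  using no_zero_div by blast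

lemma S_power_nonzero: "a \<in> S \<Longrightarrow> a \<noteq> 0 \<Longrightarrow> a ^ n \<noteq> 0"
  by (induction n) (simp_all add: S_mult_nonzero)

text \<open>Eigenvalues with zero component are dropped from a finite set until a nonzero component
  is met, which must happen as \<open>a\<close> itself is nonzero.\<close>

lemma geig_component:
  assumes "a \<in> S" "a \<noteq> 0"
  obtains l b c where "b \<in> geig {l}" "b \<noteq> 0" "c \<in> geig (- {l})" "a = b + c"
proof -
  obtain A where "finite A" "a \<in> geig A"
    using assms(1) by (rule geig_finite)
  then have "\<exists>l. \<exists>b\<in>geig {l}. \<exists>c\<in>geig (- {l}). b \<noteq> 0 \<and> a = b + c"
  proof (induction A rule: finite_psubset_induct)
    case (psubset A)
    obtain l where l: "l \<in> A"
      using psubset.prems assms(2) geig_empty by (cases "A = {}") auto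
    obtain b c where bc: "b \<in> geig (A \<inter> {l})" "c \<in> geig (A - {l})" "a = b + c"
      using psubset.prems by (rule geig_split)
    show ?case
    proof (cases "b = 0")
      case True
      with bc l psubset.IH[of "A - {l}"] show ?thesis by auto
    next
      case False
      have "b \<in> geig {l}" "c \<in> geig (- {l})"
        using bc by (blast intro: geig_mono)+
      with False bc(3) show ?thesis by blast
    qed
  qed
  with that show ?thesis by blast
qed

text \<open>An additive functional \<open>\<phi>\<close> turns the decomposition into generalized eigenspaces into a
  grading by real numbers.\<close>

definition lead :: "(complex \<Rightarrow> real) \<Rightarrow> real \<Rightarrow> 'r \<Rightarrow> 'r \<Rightarrow> bool" where
  "lead \<phi> r b a \<longleftrightarrow> b \<in> geig {l. \<phi> l = r} \<and> a - b \<in> geig {l. \<phi> l < r}"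

lemma lead_exists:
  assumes "a \<in> S" "a \<noteq> 0"
  obtains r b where "lead \<phi> r b a" "b \<noteq> 0"
proof -
  obtain A where "finite A" "a \<in> geig A"
    using assms(1) by (rule geig_finite)
  then have "\<exists>r b. lead \<phi> r b a \<and> b \<noteq> 0"
  proof (induction A rule: finite_psubset_induct)
    case (psubset A)
    have ne: "A \<noteq> {}"
      using psubset.prems assms(2) geig_empty by auto
    define r where "r = Max (\<phi> ` A)"
    have r: "\<phi> l \<le> r" if "l \<in> A" for l
      using that psubset.hyps by (simp add: r_def)
    have "r \<in> \<phi> ` A"
      unfolding r_def using ne psubset.hyps by (intro Max_in) auto
    then obtain l where l: "l \<in> A" "\<phi> l = r"
      by blast
    obtain b c where bc: "b \<in> geig (A \<inter> {l. \<phi> l = r})" "c \<in> geig (A - {l. \<phi> l = r})" "a = b + c"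
      using psubset.prems by (rule geig_split)
    show ?case
    proof (cases "b = 0")
      case True
      have "A - {l. \<phi> l = r} \<subset> A"
        using l by blast
      then show ?thesis
        using True bc psubset.IH by simp
    next
      case False
      have "b \<in> geig {l. \<phi> l = r}" 
        using bc(1) by (rule geig_mono) blast
      moreover have "c \<in> geig {l. \<phi> l < r}"
        using bc(2) by (rule geig_mono) (use r in force)
      ultimately have "lead \<phi> r b a"
        using bc(3) by (simp add: lead_def)
      with False show ?thesis by blast
    qed
  qed
  with that show ?thesis by blast
qed

text \<open>Were r < r', all of \<open>a\<close>, and hence \<open>b'\<close>, would lie in degrees
  below r', whereas \<open>b'\<close> sits in degree r'; disjoint sets of eigenvalues then force
  \<open>b' = 0\<close>.\<close>

lemma lead_degree_le:
  assumes "lead \<phi> r b a" "lead \<phi> r' b' a" "b' \<noteq> 0"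
  shows "r' \<le> r"
proof (rule ccontr)
  assume "\<not> r' \<le> r"
  then have "b \<in> geig {l. \<phi> l < r'}" "a - b \<in> geig {l. \<phi> l < r'}"
    using assms(1) unfolding lead_def by (auto elim!: geig_mono)
  then have "a \<in> geig {l. \<phi> l < r'}"
    using geig_add by fastforce
  then have "a - (a - b') \<in> geig {l. \<phi> l < r'}"
    using assms(2) unfolding lead_def by (blast intro: geig_diff)
  then have "b' \<in> geig {l. \<phi> l < r'}"
    by simp
  moreover have "b' \<in> geig {l. \<phi> l = r'}"
    using assms(2) by (simp add: lead_def)
  ultimately have "b' = 0"
    by (rule geig_disjoint) auto
  with assms(3) show False by simp
qed

text \<open>Leading parts multiply because eigenvalues add. That the product is nonzero is not part
  of the claim; it comes from the domain property where it is required.\<close>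

lemma lead_mult:
  assumes \<phi>: "\<And>l m. \<phi> (l + m) = \<phi> l + \<phi> m"
    and "lead \<phi> r b a" "lead \<phi> s d c"
  shows "lead \<phi> (r + s) (b * d) (a * c)"
proof -
  have b: "b \<in> geig {l. \<phi> l = r}" and ab: "a - b \<in> geig {l. \<phi> l < r}"
    and d: "d \<in> geig {l. \<phi> l = s}" and cd: "c - d \<in> geig {l. \<phi> l < s}"
    using assms by (simp_all add: lead_def)
  have "b + (a - b) \<in> geig {l. \<phi> l \<le> r}"
    by (intro geig_add; rule geig_mono[OF b] geig_mono[OF ab]) auto
  then have a: "a \<in> geig {l. \<phi> l \<le> r}" by simp
  have "b * d \<in> geig {l. \<phi> l = r + s}"
    by (rule geig_mult[OF b d]) (simp add: \<phi>)
  moreover have "a * (c - d) + (a - b) * d \<in> geig {l. \<phi> l < r + s}"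
    by (intro geig_add; rule geig_mult[OF a cd] geig_mult[OF ab d]) (auto simp: \<phi>)
  ultimately show ?thesis
    by (simp add: lead_def algebra_simps)
qed

lemma sc_geig: "sc c \<in> geig {0}"
  by (rule geigI[of _ "[0]"]) (simp_all add: dl_def)

text \<open>As \<open>r > 0\<close>, each constant added in Horner's scheme has degree 0, below the
  leading degree.\<close>

lemma lead_peval:
  assumes \<phi>: "\<And>l m. \<phi> (l + m) = \<phi> l + \<phi> m"
    and "lead \<phi> r b h" "r > 0" "p \<noteq> 0"
  shows "lead \<phi> (real (degree p) * r) (sc (lead_coeff p) * b ^ degree p) (peval p h)"
  using \<open>p \<noteq> 0\<close>
proof (induction p)
  case (pCons c p)
  have \<phi>0: "\<phi> 0 = 0"
    using \<phi>[of 0 0] by simp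
  have c: "sc c \<in> geig {l. \<phi> l = 0}"
    using sc_geig by (rule geig_mono) (simp add: \<phi>0)
  show ?case
  proof (cases "p = 0")
    case True
    then show ?thesis using c by (simp add: lead_def peval_pCons)
  next
    case False
    let ?n = "degree p"
    have "lead \<phi> (r + real ?n * r) (b * (sc (lead_coeff p) * b ^ ?n)) (h * peval p h)"
      using False by (intro lead_mult \<phi> assms pCons.IH)
    moreover have "r + real ?n * r > 0"
      using \<open>r > 0\<close> by (simp add: add_pos_nonneg)
    then have "sc c \<in> geig {l. \<phi> l < r + real ?n * r}"
      by (intro geig_mono[OF c]) auto
    ultimately have "lead \<phi> (r + real ?n * r) (b * (sc (lead_coeff p) * b ^ ?n)) (sc c + h * peval p h)"
      unfolding lead_def by (metis add_diff_eq geig_add)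
    then show ?thesis
      using False by (simp add: peval_pCons sc_left_comm distrib_right)
  qed
qed simp

text \<open>If \<open>h\<close> had top degree r > 0 and \<open>x\<close> top degree s, the
  right-hand side of the relation would have a leading part of degree s + d r with d =
  \<open>degree f\<close> > 1, nonzero in a domain. The left-hand side has degree at most r +
  s.\<close>

lemma intertwiner_geig_le:
  fixes \<phi> :: "complex \<Rightarrow> real"
  assumes \<phi>: "\<And>l m. \<phi> (l + m) = \<phi> l + \<phi> m"
    and S: "x \<in> S" "h \<in> S" and "x \<noteq> 0" and f: "degree f > 1" and rel: "h * x = x * peval f h"
  shows "h \<in> geig {l. \<phi> l \<le> 0}"
proof (cases "h = 0")
  case False
  obtain r b where h: "lead \<phi> r b h" "b \<noteq> 0"
    using lead_exists S(2) False by blast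
  obtain s y where x: "lead \<phi> s y x" "y \<noteq> 0"
    using lead_exists S(1) \<open>x \<noteq> 0\<close> by blast
  have "r \<le> 0"
  proof (rule ccontr)
    assume "\<not> r \<le> 0"
    then have "r > 0" by simp
    have bS: "b \<in> S" "y \<in> S"
      using h x unfolding lead_def by (blast intro: geig_S)+
    have "f \<noteq> 0" using f by auto
    have 1: "lead \<phi> (r + s) (b * y) (h * x)"
      by (intro lead_mult \<phi> h x)
    have 2: "lead \<phi> (s + real (degree f) * r) (y * (sc (lead_coeff f) * b ^ degree f)) (h * x)"
      unfolding rel by (intro lead_mult lead_peval \<phi> h x \<open>r > 0\<close> \<open>f \<noteq> 0\<close>)
    have "sc (lead_coeff f) * b ^ degree f \<noteq> 0"
      using \<open>f \<noteq> 0\<close> S_power_nonzero[OF bS(1) h(2)] by (simp add: sc_eq_0_iff)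
    then have "y * (sc (lead_coeff f) * b ^ degree f) \<noteq> 0"
      using bS x(2) by (rule_tac S_mult_nonzero) simp_all
    then have "s + real (degree f) * r \<le> r + s"
      using lead_degree_le[OF 1 2] by blast
    moreover have "real (degree f) * r > 1 * r"
      using f \<open>r > 0\<close> by (intro mult_strict_right_mono) auto
    ultimately show False by simp
  qed
  have "b \<in> geig {l. \<phi> l \<le> 0}" "h - b \<in> geig {l. \<phi> l \<le> 0}"
    using h(1) \<open>r \<le> 0\<close> unfolding lead_def by (auto elim!: geig_mono)
  then show ?thesis
    using geig_add by fastforce
qed simp

text \<open>The functionals Re, -Re, Im and -Im cut out four half-planes that meet only in
  0.\<close>

lemma intertwiner_geig_0:
  assumes "x \<in> S" "h \<in> S" "x \<noteq> 0" "degree f > 1" "h * x = x * peval f h"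
  shows "h \<in> geig {0}"
proof -
  note le = intertwiner_geig_le[OF _ assms]
  have "h \<in> geig (({l. Re l \<le> 0} \<inter> {l. - Re l \<le> 0}) \<inter> ({l. Im l \<le> 0} \<inter> {l. - Im l \<le> 0}))"
    by (intro geig_Int le) simp_all
  then show ?thesis
    by (rule geig_mono) (auto simp: complex_eq_iff)
qed

text \<open>\<open>nilp l n s a\<close> means \<open>(\<delta> - l)\<^sup>n a = n! s\<close> and \<open>(\<delta> - l)\<^sup>n\<^sup>+\<^sup>1 a = 0\<close>; the divided
  power makes the symbol \<open>s\<close> multiplicative.\<close>

fun nilp :: "complex \<Rightarrow> nat \<Rightarrow> 'r \<Rightarrow> 'r \<Rightarrow> bool" where
  "nilp l 0 s a \<longleftrightarrow> dl l a = 0 \<and> s = a"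
| "nilp l (Suc n) s a \<longleftrightarrow> nilp l n (sc (of_nat (Suc n)) * s) (dl l a)"

declare nilp.simps(2) [simp del]

text \<open>The order is the last power of \<delta> - l that does not kill \<open>a\<close>;
  dividing by \<open>Suc n\<close> at each level builds up the factorial.\<close>

lemma nilp_exists:
  assumes "a \<in> geig {l}" "a \<noteq> 0"
  obtains n s where "nilp l n s a" "s \<noteq> 0" "s \<in> S"
proof -
  obtain ls where "a \<in> S" "set ls \<subseteq> {l}" "dls ls a = 0"
    using assms(1) by (rule geigE)
  then have "\<exists>n s. nilp l n s a \<and> s \<noteq> 0 \<and> s \<in> S"
    using assms(2)
  proof (induction ls arbitrary: a)
    case (Cons m ls)
    then have [simp]: "m = l" by simp
    show ?case
    proof (cases "dl l a = 0")
      case True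
      then show ?thesis
        using Cons.prems by (intro exI[of _ 0] exI[of _ a]) simp
    next
      case False
      have "\<exists>n s. nilp l n s (dl l a) \<and> s \<noteq> 0 \<and> s \<in> S"
        by (rule Cons.IH) (use Cons.prems False in simp_all)
      then obtain n s where ns: "nilp l n s (dl l a)" "s \<noteq> 0" "s \<in> S"
        by blast
      let ?c = "of_nat (Suc n) :: complex"
      have c: "?c \<noteq> 0" 
        by (rule of_nat_neq_0)
      have "sc ?c * (sc (inverse ?c) * s) = s"
        using sc_inverse_cancel[of "inverse ?c" s] c by (simp del: of_nat_Suc)
      then have "nilp l (Suc n) (sc (inverse ?c) * s) a"
        using ns(1) by (simp add: nilp.simps(2) del: of_nat_Suc)
      moreover have "sc (inverse ?c) * s \<noteq> 0"
        using c ns(2) by (subst sc_eq_0_iff) (simp_all del: of_nat_Suc)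
      ultimately show ?thesis
        using ns(3) by (meson S_mult S_sc)
    qed
  qed simp
  with that show ?thesis by blast
qed

lemma nilp_zero: "nilp l n 0 0"
  by (induction n) (simp_all add: nilp.simps(2))

lemma nilp_add:
  assumes "a \<in> S" "b \<in> S" "nilp l n s a" "nilp l n t b"
  shows "nilp l n (s + t) (a + b)"
  using assms
  by (induction n arbitrary: a b s t) (simp_all add: nilp.simps(2) dl_add distrib_left del: of_nat_Suc)

lemma nilp_raise:
  assumes "nilp l m t b" "m < n"
  shows "nilp l n 0 b"
  using assms
proof (induction m arbitrary: n t b)
  case 0
  then obtain n' where "n = Suc n'" by (metis gr0_conv_Suc)
  with 0 show ?case by (simp add: nilp.simps(2) nilp_zero)
next
  case (Suc m)
  then obtain n' where "n = Suc n'" by (metis not_less_zero gr0_conv_Suc zero_less_Suc less_trans)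
  with Suc show ?case by (simp add: nilp.simps(2) del: of_nat_Suc)
qed

lemma nilp_unique:
  assumes "nilp l n s a" "nilp l n t a"
  shows "s = t"
  using assms
proof (induction n arbitrary: a s t)
  case (Suc n)
  then have "sc (of_nat (Suc n)) * s = sc (of_nat (Suc n)) * t"
    by (simp add: nilp.simps(2) del: of_nat_Suc)
  then show ?case
    by (subst (asm) sc_cancel) (simp_all del: of_nat_Suc)
qed simp

lemma nilp_order_unique:
  assumes "nilp l m s a" "s \<noteq> 0" "nilp l n t a" "t \<noteq> 0"
  shows "m = n"
  using assms nilp_raise nilp_unique by (metis linorder_neqE_nat)

text \<open>The two Leibniz summands contribute the multiples m and n of \<open>s * t\<close>, and
  their sum m + n is the factor that the divided power absorbs.\<close>

lemma nilp_mult: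
  assumes "a \<in> S" "b \<in> S" "nilp l m s a" "nilp k n t b"
  shows "nilp (l + k) (m + n) (s * t) (a * b)"
  using assms
proof (induction "m + n" arbitrary: m n s t a b)
  case 0
  then show ?case by (simp add: dl_mult)
next
  case (Suc N)
  have 1: "nilp (l + k) N (sc (of_nat m) * (s * t)) (dl l a * b)"
  proof (cases m)
    case 0
    then show ?thesis using Suc.prems by (simp add: nilp_zero)
  next
    case (Suc m')
    have "nilp (l + k) (m' + n) ((sc (of_nat (Suc m')) * s) * t) (dl l a * b)"
      using Suc Suc.hyps(2) Suc.prems by (intro Suc.hyps(1)) (simp_all add: nilp.simps(2))
    moreover have "m' + n = N"
      using Suc Suc.hyps(2) by simp
    ultimately show ?thesis
      using Suc by (simp add: mult.assoc)
  qed
  have 2: "nilp (l + k) N (sc (of_nat n) * (s * t)) (a * dl k b)"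
  proof (cases n)
    case 0
    then show ?thesis using Suc.prems by (simp add: nilp_zero)
  next
    case (Suc n')
    have "nilp (l + k) (m + n') (s * (sc (of_nat (Suc n')) * t)) (a * dl k b)"
      using Suc Suc.hyps(2) Suc.prems by (intro Suc.hyps(1)) (simp_all add: nilp.simps(2))
    moreover have "m + n' = N"
      using Suc Suc.hyps(2) by simp
    ultimately show ?thesis
      using Suc by (simp add: sc_left_comm)
  qed
  have "nilp (l + k) N (sc (of_nat m) * (s * t) + sc (of_nat n) * (s * t)) (dl l a * b + a * dl k b)"
    using Suc.prems by (intro nilp_add 1 2) simp_all
  moreover have "sc (of_nat m) * (s * t) + sc (of_nat n) * (s * t) = sc (of_nat (Suc N)) * (s * t)"
    by (simp only: Suc.hyps(2) of_nat_add sc_add distrib_right)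
  ultimately have "nilp (l + k) (Suc N) (s * t) (a * b)"
    using Suc.prems by (simp add: nilp.simps(2) dl_mult del: of_nat_Suc)
  then show ?case
    by (simp only: Suc.hyps(2))
qed

lemma nilp_peval:
  assumes "h \<in> S" "nilp 0 k s h" "k > 0" "p \<noteq> 0"
  shows "nilp 0 (degree p * k) (sc (lead_coeff p) * s ^ degree p) (peval p h)"
  using \<open>p \<noteq> 0\<close>
proof (induction p)
  case (pCons c p)
  have c: "nilp 0 0 (sc c) (sc c)"
    by (simp add: dl_def)
  show ?case
  proof (cases "p = 0")
    case True
    then show ?thesis using c by (simp add: peval_pCons)
  next
    case False
    let ?n = "degree p"
    have "nilp (0 + 0) (k + ?n * k) (s * (sc (lead_coeff p) * s ^ ?n)) (h * peval p h)"
      using False assms by (intro nilp_mult pCons.IH) simp_all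
    moreover have "nilp 0 (k + ?n * k) 0 (sc c)"
      using c \<open>k > 0\<close> by (rule_tac nilp_raise) auto
    ultimately have "nilp 0 (k + ?n * k) (0 + s * (sc (lead_coeff p) * s ^ ?n)) (sc c + h * peval p h)"
      using assms by (intro nilp_add) simp_all
    then show ?thesis
      using False by (simp add: peval_pCons sc_left_comm)
  qed
qed simp

text \<open>Multiplication by \<open>h\<close> and f(h), which have only the eigenvalue 0, respects
  the components of \<open>x\<close>, so a nonzero component \<open>b\<close> satisfies the same
  relation. Comparing nilpotency orders there gives k + n = n + d k with d > 1, hence k = 0.\<close>

lemma intertwiner_constant:
  assumes S: "x \<in> S" "h \<in> S" and "x \<noteq> 0" and f: "degree f > 1" and rel: "h * x = x * peval f h"
  shows "\<delta> h = 0"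
proof (cases "h = 0")
  case False
  have h0: "h \<in> geig {0}"
    by (rule intertwiner_geig_0[OF assms])
  obtain l b c where bc: "b \<in> geig {l}" "b \<noteq> 0" "c \<in> geig (- {l})" "x = b + c"
    using S(1) \<open>x \<noteq> 0\<close> by (rule geig_component)
  have fh: "peval f h \<in> geig {0}"
  proof (induction f)
    case (pCons e p)
    have "h * peval p h \<in> geig {0}"
      by (rule geig_mult[OF h0 pCons.IH]) simp
    then show ?case
      by (simp add: peval_pCons geig_add sc_geig)
  qed simp
  have 1: "h * b - b * peval f h \<in> geig {l}"
    by (intro geig_diff geig_mult[OF h0 bc(1)] geig_mult[OF bc(1) fh]) simp_all
  have "c * peval f h - h * c \<in> geig (- {l})"
    by (intro geig_diff geig_mult[OF h0 bc(3)] geig_mult[OF bc(3) fh]) simp_all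
  \<comment> \<open>The relation for \<open>x\<close> balances the defect of \<open>b\<close>
    against that of \<open>c\<close>, and the two lie in complementary eigenspaces.\<close>
  moreover have "c * peval f h - h * c = h * b - b * peval f h"
    using rel by (simp add: bc(4) algebra_simps)
  ultimately have "h * b - b * peval f h \<in> geig (- {l})"
    by simp
  then have relb: "h * b = b * peval f h"
    using geig_disjoint[OF 1, of "- {l}"] by simp
  obtain n t where nt: "nilp l n t b" "t \<noteq> 0" "t \<in> S"
    using bc(1,2) by (rule nilp_exists)
  obtain k s where ks: "nilp 0 k s h" "s \<noteq> 0" "s \<in> S"
    using h0 False by (rule nilp_exists)
  have "k = 0"
  proof (rule ccontr)
    assume "k \<noteq> 0"
    then have "k > 0" by simp
    have "f \<noteq> 0" using f by auto
    have bS: "b \<in> S" using bc(1) by (rule geig_S)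
    have "nilp (0 + l) (k + n) (s * t) (h * b)"
      by (intro nilp_mult S bS ks nt)
    moreover have "nilp (l + 0) (n + degree f * k) (t * (sc (lead_coeff f) * s ^ degree f)) (h * b)"
      unfolding relb
      using S by (intro nilp_mult S nt(1) bS nilp_peval[OF S(2) ks(1)] \<open>k > 0\<close> \<open>f \<noteq> 0\<close>) simp
    moreover have "s * t \<noteq> 0"
      by (intro S_mult_nonzero ks nt)
    moreover have "sc (lead_coeff f) * s ^ degree f \<noteq> 0"
      using \<open>f \<noteq> 0\<close> S_power_nonzero[OF ks(3) ks(2)] by (simp add: sc_eq_0_iff)
    then have "t * (sc (lead_coeff f) * s ^ degree f) \<noteq> 0"
      using ks nt by (rule_tac S_mult_nonzero) simp_all
    ultimately have "k + n = n + degree f * k"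
      using nilp_order_unique[of l "k + n" _ "h * b"] by (metis add.right_neutral add.left_neutral)
    moreover have "degree f * k > 1 * k"
      using f \<open>k > 0\<close> by (intro mult_strict_right_mono) auto
    ultimately show False by linarith
  qed
  with ks(1) show ?thesis
    by (simp add: dl_def)
qed simp

end

section \<open>A faithful module\<close>

text \<open>A type of its own makes the endomorphisms an instance of \<open>ring_1\<close>.
  Linearity is over the coefficients, later \<complex>[h], so an endomorphism is a matrix indexed by
  the powers of the outer variable.\<close>

typedef (overloaded) ('a::comm_ring_1) lin_endo =
  "{g :: 'a poly \<Rightarrow> 'a poly. (\<forall>u v. g (u + v) = g u + g v) \<and>
      (\<forall>c v. g (Polynomial.smult c v) = Polynomial.smult c (g v))}"
  morphisms app Lin_Endo
  by (rule exI[of _ "\<lambda>_. 0"]) simp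

setup_lifting type_definition_lin_endo

instantiation lin_endo :: (comm_ring_1) ring_1
begin

lift_definition zero_lin_endo :: "'a lin_endo" is "\<lambda>_. 0" by simp

lift_definition one_lin_endo :: "'a lin_endo" is "\<lambda>v. v" by simp

lift_definition plus_lin_endo :: "'a lin_endo \<Rightarrow> 'a lin_endo \<Rightarrow> 'a lin_endo"
  is "\<lambda>g g' v. g v + g' v" by (simp add: smult_add_right)

lift_definition minus_lin_endo :: "'a lin_endo \<Rightarrow> 'a lin_endo \<Rightarrow> 'a lin_endo"
  is "\<lambda>g g' v. g v - g' v" by (simp add: smult_diff_right)

lift_definition uminus_lin_endo :: "'a lin_endo \<Rightarrow> 'a lin_endo"
  is "\<lambda>g v. - g v" by simp

lift_definition times_lin_endo :: "'a lin_endo \<Rightarrow> 'a lin_endo \<Rightarrow> 'a lin_endo"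
  is "\<lambda>g g' v. g (g' v)" by simp

instance
proof
  show "(0 :: 'a lin_endo) \<noteq> 1"
    by transfer (metis one_neq_zero)
qed (transfer; simp add: fun_eq_iff algebra_simps)+

end

lemma app_0 [simp]: "app 0 v = 0"
  and app_1 [simp]: "app 1 v = v"
  and app_plus [simp]: "app (a + b) v = app a v + app b v"
  and app_minus [simp]: "app (a - b) v = app a v - app b v"
  and app_times [simp]: "app (a * b) v = app a (app b v)"
  and app_add_right: "app a (v + w) = app a v + app a w"
  and app_smult_right: "app a (Polynomial.smult c v) = Polynomial.smult c (app a v)"
  by (transfer; simp)+

lemma app_0_right [simp]: "app a 0 = 0"
  using app_smult_right[of a 0 0] by simp

lemma app_sum: "app (sum g A) v = (\<Sum>i\<in>A. app (g i) v)"
  by (induction A rule: infinite_finite_induct) auto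

lemma app_sum_right: "app a (sum g A) = (\<Sum>i\<in>A. app a (g i))"
  by (induction A rule: infinite_finite_induct) (auto simp: app_add_right)

lemma poly_sum_monoms_degree:
  "v = (\<Sum>n\<le>degree v. Polynomial.smult (coeff v n) (monom 1 n))"
  for v :: "'a::comm_ring_1 poly"
  by (simp add: smult_monom poly_as_sum_of_monoms)

lemma app_eq_sum:
  "app a v = (\<Sum>n\<le>degree v. Polynomial.smult (coeff v n) (app a (monom 1 n)))"
  by (subst poly_sum_monoms_degree[of v]) (simp only: app_sum_right app_smult_right)

lemma lin_endo_eqI:
  assumes "\<And>n. app a (monom 1 n) = app b (monom 1 n)"
  shows "a = b"
proof -
  have "app a v = app b v" for v
    by (simp add: app_eq_sum[of _ v] assms)
  then show ?thesis
    by (simp add: app_inject[symmetric] fun_eq_iff)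
qed

lemma lin_endo_monom_eqI: "(\<And>c n. app a (monom c n) = app b (monom c n)) \<Longrightarrow> a = b"
  by (rule lin_endo_eqI)

lemma smult_sum_right:
  "Polynomial.smult c (sum g A) = (\<Sum>i\<in>A. Polynomial.smult c (g i))"
  by (induction A rule: infinite_finite_induct) (auto simp: smult_add_right)

lift_definition lin_of :: "(nat \<Rightarrow> 'a poly) \<Rightarrow> 'a::comm_ring_1 lin_endo"
  is "\<lambda>w v. \<Sum>n\<le>degree v. Polynomial.smult (coeff v n) (w n)"
proof (intro conjI allI)
  fix w :: "nat \<Rightarrow> 'a poly" and u v :: "'a poly" and c
  have bound: "(\<Sum>n\<le>degree v. Polynomial.smult (coeff v n) (w n)) = 
      (\<Sum>n\<le>N. Polynomial.smult (coeff v n) (w n))" if "degree v \<le> N" for v :: "'a poly" and N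
    using that by (intro sum.mono_neutral_left) (auto simp: coeff_eq_0)
  define N where "N = max (degree u) (degree v)"
  have N: "degree (u + v) \<le> N" "degree u \<le> N" "degree v \<le> N"
    by (auto simp: N_def degree_add_le_max)
  show "(\<Sum>n\<le>degree (u + v). Polynomial.smult (coeff (u + v) n) (w n)) =
      (\<Sum>n\<le>degree u. Polynomial.smult (coeff u n) (w n)) +
      (\<Sum>n\<le>degree v. Polynomial.smult (coeff v n) (w n))"
    by (simp only: N[THEN bound]) (simp add: smult_add_left sum.distrib)
  show "(\<Sum>n\<le>degree (Polynomial.smult c v). Polynomial.smult (coeff (Polynomial.smult c v) n) (w n)) =
      Polynomial.smult c (\<Sum>n\<le>degree v. Polynomial.smult (coeff v n) (w n))"
    by (subst bound[OF degree_smult_le]) (simp add: smult_sum_right)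
qed

lemma app_lin_of_monom [simp]: "app (lin_of w) (monom c n) = Polynomial.smult c (w n)"
proof (cases "c = 0")
  case False
  have "(\<Sum>k\<le>n. Polynomial.smult (coeff (monom c n) k) (w k)) =
      (\<Sum>k\<le>n. if k = n then Polynomial.smult c (w k) else 0)"
    by (intro sum.cong) auto
  with False show ?thesis
    by (simp add: lin_of.rep_eq degree_monom_eq)
qed simp

section \<open>Endomorphisms that shift large degrees\<close>

definition shifts_degree :: "'a::comm_ring_1 lin_endo \<Rightarrow> int \<Rightarrow> bool" where
  "shifts_degree a m \<longleftrightarrow> (\<exists>N. \<forall>v. N \<le> degree v \<longrightarrow> int (degree (app a v)) = int (degree v) + m)"

text \<open>The shift is required for every \<open>v\<close> of large degree, not only for
  monomials, and this is what makes it pass to compositions.\<close>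

lemma shifts_degree_mult:
  assumes "shifts_degree a m" "shifts_degree b n"
  shows "shifts_degree (a * b) (m + n)"
proof -
  obtain M where M: "\<And>v. M \<le> degree v \<Longrightarrow> int (degree (app a v)) = int (degree v) + m"
    using assms(1) unfolding shifts_degree_def by blast
  obtain N where N: "\<And>v. N \<le> degree v \<Longrightarrow> int (degree (app b v)) = int (degree v) + n"
    using assms(2) unfolding shifts_degree_def by blast
  have "int (degree (app (a * b) v)) = int (degree v) + (m + n)"
    if "max N (nat (int M - n)) \<le> degree v" for v
    using N[of v] M[of "app b v"] that by auto
  then show ?thesis
    unfolding shifts_degree_def by blast
qed

lemma shifts_degree_nonzero:
  assumes "shifts_degree a m"
  shows "a \<noteq> 0"
proof
  assume "a = 0"
  obtain N where N: "\<And>v. N \<le> degree v \<Longrightarrow> int (degree (app a v)) = int (degree v) + m"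
    using assms unfolding shifts_degree_def by blast
  \<comment> \<open>This \<open>n\<close> is at least \<open>N\<close> and makes n + m positive,
    whereas the zero map returns degree 0.\<close>
  define n where "n = Suc (N + nat (- m))"
  have "degree (monom (1::'a) n) = n"
    by (rule degree_monom_eq) simp
  then have "int n + m = 0"
    using N[of "monom 1 n"] \<open>a = 0\<close> by (simp add: n_def)
  then show False
    by (simp add: n_def split: if_splits)
qed

text \<open>Only the top monomial of \<open>v\<close> reaches the coefficient at
  \<open>degree v\<close> + m, so testing on powers of the variable suffices.\<close>

lemma shifts_degreeI:
  fixes a :: "'a::idom lin_endo"
  assumes above: "\<And>n i. coeff (app a (monom 1 n)) i \<noteq> 0 \<Longrightarrow> int i \<le> int n + m"
    and top: "\<And>n. N \<le> n \<Longrightarrow> \<exists>i. int i = int n + m \<and> coeff (app a (monom 1 n)) i \<noteq> 0"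
  shows "shifts_degree a m"
proof -
  \<comment> \<open>The bound \<open>Suc N\<close> excludes v = 0, whose degree is 0.\<close>
  have "int (degree (app a v)) = int (degree v) + m" if v: "Suc N \<le> degree v" for v
  proof -
    let ?d = "degree v"
    obtain i where i: "int i = int ?d + m" "coeff (app a (monom 1 ?d)) i \<noteq> 0"
      using top[of ?d] v by auto
    have eq: "coeff (app a v) j = (\<Sum>n\<le>?d. coeff v n * coeff (app a (monom 1 n)) j)" for j
      by (subst app_eq_sum) (simp add: coeff_sum)
    have "coeff (app a v) j = 0" if "j > i" for j
      unfolding eq using that i(1) above by (intro sum.neutral) fastforce
    then have "degree (app a v) \<le> i"
      by (intro degree_le) auto
    moreover have "coeff (app a v) i = coeff v ?d * coeff (app a (monom 1 ?d)) i"
      unfolding eq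
    proof (subst sum.remove[of _ ?d])
      have "(\<Sum>n\<in>{..?d} - {?d}. coeff v n * coeff (app a (monom 1 n)) i) = 0"
        using i(1) above by (intro sum.neutral) fastforce
      then show "coeff v ?d * coeff (app a (monom 1 ?d)) i +
          (\<Sum>n\<in>{..?d} - {?d}. coeff v n * coeff (app a (monom 1 n)) i) =
          coeff v ?d * coeff (app a (monom 1 ?d)) i" by simp
    qed auto
    moreover have "v \<noteq> 0"
      using v by auto
    ultimately have "degree (app a v) = i"
      using i(2) le_degree[of "app a v" i] by simp
    with i(1) show ?thesis by simp
  qed
  then show ?thesis
    unfolding shifts_degree_def by blast
qed

definition endo_sc :: "complex \<Rightarrow> complex poly lin_endo" where
  "endo_sc c = lin_of (\<lambda>n. monom [:c:] n)"

lemma app_endo_sc [simp]: "app (endo_sc c) v = Polynomial.smult [:c:] v"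
proof -
  have "app (endo_sc c) v = (\<Sum>n\<le>degree v. Polynomial.smult [:c:] (Polynomial.smult (coeff v n) (monom 1 n)))"
    by (simp add: app_eq_sum[of _ v] endo_sc_def smult_monom mult.commute)
  also have "\<dots> = Polynomial.smult [:c:] v"
    by (simp only: poly_sum_monoms_degree[symmetric] flip: smult_sum_right)
  finally show ?thesis .
qed

interpretation endo: central_scalars endo_sc
proof
  show "endo_sc 1 = 1"
    by (rule lin_endo_eqI) (simp flip: one_pCons)
  show "endo_sc (c + d) = endo_sc c + endo_sc d" for c d
    by (rule lin_endo_eqI) (simp flip: smult_add_left)
  show "endo_sc (c * d) = endo_sc c * endo_sc d" for c d
    by (rule lin_endo_eqI) (simp add: mult.commute)
  show "endo_sc c * a = a * endo_sc c" for c a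
    by (rule lin_endo_eqI) (simp only: app_times app_endo_sc app_smult_right)
qed

section \<open>Nonvanishing of substituted bivariate polynomials\<close>

lemma sum_distinct_degrees_nonzero:
  fixes t :: "'b \<Rightarrow> 'a::comm_monoid_add poly"
  assumes "finite A" "A \<noteq> {}" "\<And>l. l \<in> A \<Longrightarrow> t l \<noteq> 0" "inj_on (\<lambda>l. degree (t l)) A"
  shows "sum t A \<noteq> 0"
proof -
  have "Max ((\<lambda>l. degree (t l)) ` A) \<in> (\<lambda>l. degree (t l)) ` A"
    using assms by (intro Max_in) auto
  then obtain l where l: "l \<in> A" "degree (t l) = Max ((\<lambda>l. degree (t l)) ` A)"
    by auto
  have "degree (t k) < degree (t l)" if "k \<in> A - {l}" for k
  proof -
    have "degree (t k) \<le> degree (t l)"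
      using that assms(1) l by simp
    moreover have "degree (t k) \<noteq> degree (t l)"
      using that l inj_onD[OF assms(4), of k l] by auto
    ultimately show ?thesis by simp
  qed
  then have "coeff (sum t A) (degree (t l)) = lead_coeff (t l)"
    using assms(1) l(1) by (simp add: coeff_sum sum.remove coeff_eq_0)
  then show ?thesis
    using assms(3)[OF l(1)] by auto
qed

text \<open>Substituting \<open>s\<close> for the coefficient variable and the coefficient variable itself for the
  outer variable of a bivariate polynomial.\<close>

definition subst2 :: "'a::comm_ring_1 poly \<Rightarrow> 'a poly poly \<Rightarrow> 'a poly" where
  "subst2 s G = poly (map_poly (\<lambda>q. q \<circ>\<^sub>p s) G) [:0, 1:]"

lemma subst2_0 [simp]: "subst2 s 0 = 0"
  by (simp add: subst2_def)

lemma subst2_pCons: "subst2 s (pCons q G) = (q \<circ>\<^sub>p s) + [:0, 1:] * subst2 s G"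
  by (simp add: subst2_def map_poly_pCons)

lemma subst2_add: "subst2 s (G + H) = subst2 s G + subst2 s H"
  by (induction G H rule: poly_induct2) (simp_all add: subst2_pCons pcompose_add distrib_left)

lemma subst2_smult: "subst2 s (Polynomial.smult q G) = (q \<circ>\<^sub>p s) * subst2 s G"
  by (induction G) (simp_all add: subst2_pCons pcompose_mult distrib_left mult_ac)

lemma subst2_mult: "subst2 s (G * H) = subst2 s G * subst2 s H"
  by (induction G) (simp_all add: subst2_pCons subst2_add subst2_smult algebra_simps)

lemma subst2_sum: "subst2 s (sum G A) = (\<Sum>i\<in>A. subst2 s (G i))"
  by (induction A rule: infinite_finite_induct) (simp_all add: subst2_add)

lemma subst2_prod: "subst2 s (prod G A) = (\<Prod>i\<in>A. subst2 s (G i))"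
proof -
  have [simp]: "subst2 s 1 = 1"
    by (simp add: one_pCons subst2_pCons)
  show ?thesis
    by (induction A rule: infinite_finite_induct) (simp_all add: subst2_mult)
qed

lemma subst2_eq_sum: "subst2 s G = (\<Sum>l\<le>degree G. (coeff G l \<circ>\<^sub>p s) * monom 1 l)"
proof (induction G)
  case (pCons q G)
  have "subst2 s (pCons q G) = (q \<circ>\<^sub>p s) + [:0, 1:] * (\<Sum>l\<le>degree G. (coeff G l \<circ>\<^sub>p s) * monom 1 l)"
    by (simp add: subst2_pCons pCons.IH)
  also have "\<dots> = (\<Sum>l\<le>Suc (degree G). (coeff (pCons q G) l \<circ>\<^sub>p s) * monom 1 l)"
    by (subst sum.atMost_Suc_shift) (simp add: sum_distrib_left monom_Suc algebra_simps)
  also have "\<dots> = (\<Sum>l\<le>degree (pCons q G). (coeff (pCons q G) l \<circ>\<^sub>p s) * monom 1 l)"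
    by (intro sum.mono_neutral_right) (auto simp: coeff_eq_0 degree_pCons_eq_if)
  finally show ?case .
qed simp

text \<open>The degrees of the summands of \<open>subst2 s G\<close> are distinct modulo the degree of \<open>s\<close>.\<close>

lemma subst2_nonzero:
  fixes G :: "'a::idom poly poly"
  assumes "G \<noteq> 0" "degree G < degree s"
  shows "subst2 s G \<noteq> 0"
proof -
  define A where "A = {l. l \<le> degree G \<and> coeff G l \<noteq> 0}"
  define t where "t l = (coeff G l \<circ>\<^sub>p s) * monom 1 l" for l
  have s: "degree s > 0" using assms by simp
  have A: "finite A" "degree G \<in> A"
    using assms(1) by (auto simp: A_def)
  have t: "t l \<noteq> 0" "degree (t l) = degree (coeff G l) * degree s + l" if "l \<in> A" for l
  proof -
    have "coeff G l \<circ>\<^sub>p s \<noteq> 0"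
      using that s by (simp add: A_def pcompose_eq_0_iff)
    then show "t l \<noteq> 0" "degree (t l) = degree (coeff G l) * degree s + l"
      by (simp_all add: t_def degree_mult_eq degree_monom_eq degree_pcompose)
  qed
  have "inj_on (\<lambda>l. degree (t l)) A"
  proof (rule inj_onI)
    fix k l assume kl: "k \<in> A" "l \<in> A" "degree (t k) = degree (t l)"
    then have "(degree (coeff G k) * degree s + k) mod degree s =
        (degree (coeff G l) * degree s + l) mod degree s"
      by (simp add: t)
    moreover have "k < degree s" "l < degree s"
      using kl assms(2) by (auto simp: A_def)
    ultimately show "k = l" by simp
  qed
  then have "sum t A \<noteq> 0"
    using A t by (intro sum_distinct_degrees_nonzero) auto
  also have "sum t A = subst2 s G"
    unfolding subst2_eq_sum t_def by (intro sum.mono_neutral_left) (auto simp: A_def)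
  finally show ?thesis .
qed

section \<open>Normally ordered words\<close>

context central_scalars
begin

text \<open>All powers of h between x^i and y^k are gathered in one polynomial, so a normal form is
  a finitely supported family of polynomials indexed by the pairs (i, k).\<close>

definition nf_word :: "'r \<Rightarrow> 'r \<Rightarrow> 'r \<Rightarrow> nat \<times> nat \<Rightarrow> complex poly \<Rightarrow> 'r" where
  "nf_word x h y t q = x ^ fst t * peval q h * y ^ snd t"

definition nf :: "'r \<Rightarrow> 'r \<Rightarrow> 'r \<Rightarrow> (nat \<times> nat \<Rightarrow>\<^sub>0 complex poly) \<Rightarrow> 'r" where
  "nf x h y P = (\<Sum>t\<in>Poly_Mapping.keys P. nf_word x h y t (Poly_Mapping.lookup P t))"

lemma nf_word_0 [simp]: "nf_word x h y t 0 = 0"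
  by (simp add: nf_word_def)

lemma nf_word_add: "nf_word x h y t (p + q) = nf_word x h y t p + nf_word x h y t q"
  by (simp add: nf_word_def peval_add algebra_simps)

lemma nf_superset:
  assumes "finite A" "Poly_Mapping.keys P \<subseteq> A"
  shows "nf x h y P = (\<Sum>t\<in>A. nf_word x h y t (Poly_Mapping.lookup P t))"
  unfolding nf_def using assms
  by (intro sum.mono_neutral_left) (auto simp: in_keys_iff)

lemma nf_0 [simp]: "nf x h y 0 = 0"
  by (simp add: nf_def)

lemma nf_add: "nf x h y (P + Q) = nf x h y P + nf x h y Q"
proof -
  let ?A = "Poly_Mapping.keys P \<union> Poly_Mapping.keys Q"
  have "nf x h y (P + Q) = (\<Sum>t\<in>?A. nf_word x h y t (Poly_Mapping.lookup (P + Q) t))"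
    by (rule nf_superset) (simp_all add: Poly_Mapping.keys_add)
  then show ?thesis
    by (simp add: nf_superset[of ?A] lookup_add nf_word_add sum.distrib)
qed

lemma nf_single: "nf x h y (Poly_Mapping.single t q) = nf_word x h y t q"
  by (simp add: nf_def)

end

section \<open>Iterates of f and the representation by shifts\<close>

context
  fixes f :: "complex poly"
begin

fun iter_poly :: "nat \<Rightarrow> complex poly" where
  "iter_poly 0 = [:0, 1:]"
| "iter_poly (Suc n) = f \<circ>\<^sub>p iter_poly n"

lemma iter_poly_add: "iter_poly (m + n) = iter_poly m \<circ>\<^sub>p iter_poly n"
  by (induction m) (simp_all add: pcompose_pCons pcompose_assoc)

lemma degree_iter_poly: "degree (iter_poly n) = degree f ^ n"
  by (induction n) (simp_all add: degree_pcompose)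

text \<open>The polynomial variable of \<open>\<complex>[h][X]\<close> stands for \<open>x\<close> in the module \<open>H / H y\<close>, where
  \<open>h x\<^sup>n = x\<^sup>n f\<^sup>n(h)\<close> and \<open>y x\<^sup>n = x\<^sup>n\<^sup>-\<^sup>1 (f\<^sup>n(h) - h)\<close> for the iterates \<open>f\<^sup>n\<close> of \<open>f\<close>.
  The truncated \<open>n - 1\<close> below is harmless, as the coefficient vanishes for \<open>n = 0\<close>.\<close>

definition model_x :: "complex poly lin_endo" where
  "model_x = lin_of (\<lambda>n. monom 1 (Suc n))"

definition model_h :: "complex poly lin_endo" where
  "model_h = lin_of (\<lambda>n. monom (iter_poly n) n)"

definition model_y :: "complex poly lin_endo" where
  "model_y = lin_of (\<lambda>n. monom (iter_poly n - iter_poly 0) (n - 1))"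

lemma app_model_x [simp]: "app model_x (monom q n) = monom q (Suc n)"
  and app_model_h [simp]: "app model_h (monom q n) = monom (q * iter_poly n) n"
  and app_model_y: "app model_y (monom q n) = monom (q * (iter_poly n - iter_poly 0)) (n - 1)"
  by (simp_all add: model_x_def model_h_def model_y_def smult_monom)

lemma app_model_y_0 [simp]: "app model_y (monom q 0) = 0"
  and app_model_y_Suc [simp]: "app model_y (monom q (Suc n)) = monom (q * (iter_poly (Suc n) - iter_poly 0)) n"
  by (simp_all add: app_model_y del: iter_poly.simps(2))

declare iter_poly.simps [simp del]

lemma app_peval_h [simp]: "app (endo.peval p model_h) (monom q n) = monom (q * (p \<circ>\<^sub>p iter_poly n)) n"
proof (induction p arbitrary: q)
  case (pCons c p)
  then show ?case
    by (simp add: endo.peval_pCons pcompose_pCons smult_monom add_monom algebra_simps)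
qed (simp add: endo.peval_def)

lemma model_hx: "model_h * model_x = model_x * endo.peval f model_h"
  by (rule lin_endo_monom_eqI) (simp add: iter_poly.simps)

lemma model_yh: "model_y * model_h = endo.peval f model_h * model_y"
proof (rule lin_endo_monom_eqI)
  fix q n
  show "app (model_y * model_h) (monom q n) = app (endo.peval f model_h * model_y) (monom q n)"
    by (cases n) (simp_all add: iter_poly.simps(2) mult.commute)
qed

lemma model_yx: "model_y * model_x - model_x * model_y = endo.peval f model_h - model_h"
proof (rule lin_endo_monom_eqI)
  fix q n
  show "app (model_y * model_x - model_x * model_y) (monom q n) =
      app (endo.peval f model_h - model_h) (monom q n)"
    by (cases n) (simp_all add: diff_monom iter_poly.simps(2) algebra_simps)
qed

lemma app_model_x_power [simp]: "app (model_x ^ i) (monom q n) = monom q (n + i)"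
  by (induction i arbitrary: n) (simp_all add: power_Suc2 del: power_Suc)

lemma app_model_y_power:
  "app (model_y ^ k) (monom q n) =
    (if k \<le> n then monom (q * (\<Prod>j<k. iter_poly (n - j) - iter_poly 0)) (n - k) else 0)"
proof (induction k)
  case (Suc k)
  show ?case
  proof (cases "k < n")
    case True
    then have "n - k = Suc (n - Suc k)" by simp
    then have "app model_y (monom r (n - k)) = monom (r * (iter_poly (n - k) - iter_poly 0)) (n - Suc k)" for r
      by simp
    with True Suc show ?thesis by (simp add: mult_ac)
  next
    case False
    with Suc show ?thesis by (cases "k = n") auto
  qed
qed simp

lemma app_model_word:
  "app (model_x ^ i * endo.peval p model_h * model_y ^ k) (monom 1 n) =
    (if k \<le> n then monom ((p \<circ>\<^sub>p iter_poly (n - k)) * (\<Prod>j<k. iter_poly (n - j) - iter_poly 0)) (n - k + i) else 0)"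
  by (simp add: app_model_y_power mult_ac)

text \<open>With \<open>K = Max B\<close>, \<open>n = N + K\<close> and \<open>s = iter_poly N\<close>, all the \<open>iter_poly (n - j)\<close> with \<open>j \<le> K\<close>
  are polynomials in \<open>s\<close>, so the sum below is \<open>subst2 s G\<close> for a polynomial \<open>G\<close> that does not depend
  on \<open>N\<close>; its degree in the outer variable is \<open>K\<close>.\<close>

lemma word_entries_nonzero:
  assumes f: "degree f > 1" and B: "finite B" "B \<noteq> {}" and q: "\<And>k. k \<in> B \<Longrightarrow> q k \<noteq> 0"
    and n: "n \<ge> 2 * Max B"
  shows "(\<Sum>k\<in>B. (q k \<circ>\<^sub>p iter_poly (n - k)) * (\<Prod>j<k. iter_poly (n - j) - iter_poly 0)) \<noteq> 0"
proof -
  define K where "K = Max B"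
  have K: "K \<in> B" "\<And>k. k \<in> B \<Longrightarrow> k \<le> K"
    using B by (auto simp: K_def)
  define T where "T k = Polynomial.smult (q k \<circ>\<^sub>p iter_poly (K - k)) (\<Prod>j<k. [:iter_poly (K - j), - 1:])" for k
  define G where "G = sum T B"
  define N where "N = n - K"
  have N: "n = N + K" "N \<ge> K"
    using n by (auto simp: N_def K_def)
  have prod: "degree (\<Prod>j<k. [:iter_poly (K - j), - 1:]) = k"
    "lead_coeff (\<Prod>j<k. [:iter_poly (K - j), - 1:]) = (- 1) ^ k" for k
    by (simp add: degree_prod_sum_eq, simp only: lead_coeff_prod, simp)
  have "degree (T k) \<le> k" for k
    unfolding T_def using degree_smult_le prod(1) by (metis (lifting))
  note T = this
  \<comment> \<open>Since \<open>T k\<close> has outer degree at most k, only \<open>T K\<close>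
    contributes to this coefficient.\<close>
  have "coeff G K = coeff (T K) K + (\<Sum>k\<in>B - {K}. coeff (T k) K)"
    unfolding G_def using B K by (simp add: coeff_sum sum.remove)
  also have "(\<Sum>k\<in>B - {K}. coeff (T k) K) = 0"
  proof (intro sum.neutral ballI)
    fix k assume "k \<in> B - {K}"
    then have "degree (T k) < K" using T[of k] K(2)[of k] by auto
    then show "coeff (T k) K = 0" by (rule coeff_eq_0)
  qed
  also have "coeff (T K) K = q K * (- 1) ^ K"
    using prod[of K] by (simp add: T_def iter_poly.simps(1))
  finally have "coeff G K \<noteq> 0"
    using q[OF K(1)] by simp
  then have "G \<noteq> 0" by auto
  have "degree G \<le> K"
    unfolding G_def using B(1) T K by (intro degree_sum_le) (auto intro: order_trans)
  \<comment> \<open>The hypothesis on \<open>n\<close> gives \<open>N\<close> \<ge>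
    \<open>K\<close>, so the degree of the substituted iterate is at least 2 ^ K and exceeds the
    outer degree of \<open>G\<close>.\<close>
  also have "K < 2 ^ K" by (rule less_exp)
  also have "\<dots> \<le> degree f ^ K" using f by (intro power_mono) auto
  also have "\<dots> \<le> degree (iter_poly N)" using f N by (simp add: degree_iter_poly power_increasing)
  finally have "subst2 (iter_poly N) G \<noteq> 0"
    using \<open>G \<noteq> 0\<close> by (intro subst2_nonzero)
  also have "subst2 (iter_poly N) G = (\<Sum>k\<in>B. (q k \<circ>\<^sub>p iter_poly (n - k)) * (\<Prod>j<k. iter_poly (n - j) - iter_poly 0))"
    unfolding G_def subst2_sum
  proof (intro sum.cong refl)
    fix k assume "k \<in> B"
    then have k: "k \<le> K" by (rule K)
    have iter_poly_n: "iter_poly (K - j) \<circ>\<^sub>p iter_poly N = iter_poly (n - j)" if "j \<le> k" for j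
      using iter_poly_add[of "K - j" N] that k N by (simp add: add.commute)
    have 1: "(q k \<circ>\<^sub>p iter_poly (K - k)) \<circ>\<^sub>p iter_poly N = q k \<circ>\<^sub>p iter_poly (n - k)"
      by (simp add: iter_poly_n pcompose_assoc[symmetric])
    have 2: "subst2 (iter_poly N) [:iter_poly (K - j), - 1:] = iter_poly (n - j) - iter_poly 0" if "j < k" for j
      using that iter_poly_n[of j] by (simp add: subst2_pCons iter_poly.simps(1) pcompose_uminus one_pCons)
    show "subst2 (iter_poly N) (T k) = (q k \<circ>\<^sub>p iter_poly (n - k)) * (\<Prod>j<k. iter_poly (n - j) - iter_poly 0)"
      by (simp add: T_def subst2_smult subst2_prod 1 2)
  qed
  finally show ?thesis .
qed

lemma app_nf_word:
  "app (endo.nf_word model_x model_h model_y t q) (monom 1 n) =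
    (if snd t \<le> n
     then monom ((q \<circ>\<^sub>p iter_poly (n - snd t)) * (\<Prod>j<snd t. iter_poly (n - j) - iter_poly 0)) (n - snd t + fst t)
     else 0)"
  unfolding endo.nf_word_def by (rule app_model_word)

text \<open>Let m be the largest i - k among the words x^i q(h) y^k that occur. Words with smaller i
  - k do not reach degree n + m, and those with i - k = m are determined by k, so the coefficient
  there is the sum treated in \<open>word_entries_nonzero\<close>.\<close>

lemma nf_shifts_degree:
  assumes f: "degree f > 1" and P: "P \<noteq> 0"
  shows "\<exists>m. shifts_degree (endo.nf model_x model_h model_y P) m"
proof -
  let ?K = "Poly_Mapping.keys P" and ?d = "\<lambda>t :: nat \<times> nat. int (fst t) - int (snd t)"
  let ?E = "\<lambda>t n. (Poly_Mapping.lookup P t \<circ>\<^sub>p iter_poly (n - snd t)) * (\<Prod>j<snd t. iter_poly (n - j) - iter_poly 0)"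
  have K: "finite ?K" "?K \<noteq> {}"
    using P by simp_all
  define m where "m = Max (?d ` ?K)"
  have m: "?d t \<le> m" if "t \<in> ?K" for t
    using that by (simp add: m_def)
  have "m \<in> ?d ` ?K"
    unfolding m_def using K by (intro Max_in) auto
  define D where "D = {t \<in> ?K. ?d t = m}"
  have D: "finite D" "D \<noteq> {}"
    using \<open>m \<in> ?d ` ?K\<close> K(1) unfolding D_def by (simp, blast)
  have inj: "inj_on snd D"
    by (rule inj_onI) (auto simp: D_def prod_eq_iff)
  define t where "t = (\<lambda>k. (nat (int k + m), k))"
  have t: "t (snd u) = u" if "u \<in> D" for u
    using that by (auto simp: t_def D_def prod_eq_iff)
  have entry: "coeff (app (endo.nf model_x model_h model_y P) (monom 1 n)) l =
      (\<Sum>t\<in>?K. if snd t \<le> n \<and> l = n - snd t + fst t then ?E t n else 0)" for n l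
    unfolding endo.nf_def app_sum coeff_sum by (intro sum.cong) (auto simp: app_nf_word)
  have "shifts_degree (endo.nf model_x model_h model_y P) m"
  proof (rule shifts_degreeI)
    fix n l assume "coeff (app (endo.nf model_x model_h model_y P) (monom 1 n)) l \<noteq> 0"
    then obtain u where "u \<in> ?K" "(if snd u \<le> n \<and> l = n - snd u + fst u then ?E u n else 0) \<noteq> 0"
      unfolding entry by (rule sum.not_neutral_contains_not_neutral)
    then have "u \<in> ?K" "snd u \<le> n" "l = n - snd u + fst u"
      by (meson)+
    then show "int l \<le> int n + m"
      using m[of u] by simp
  next
    \<comment> \<open>The summand \<open>nat (- m)\<close> makes n + m nonnegative, so the
      conversion in \<open>l\<close> below loses nothing.\<close>
    fix n assume n: "2 * Max (snd ` D) + nat (- m) \<le> n"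
    define l where "l = nat (int n + m)"
    have snd: "snd u \<le> n" if "u \<in> D" for u
    proof -
      have "snd u \<le> Max (snd ` D)" using that D by simp
      with n show ?thesis by simp
    qed
    have l: "int l = int n + m"
      using n by (simp add: l_def)
    have "coeff (app (endo.nf model_x model_h model_y P) (monom 1 n)) l = (\<Sum>u\<in>D. ?E u n)"
      unfolding entry using l snd
      by (intro sum.mono_neutral_cong_right) (auto simp: D_def)
    also have "\<dots> = (\<Sum>k\<in>snd ` D. ?E (t k) n)"
      using t by (simp add: sum.reindex[OF inj])
    also have "\<dots> = (\<Sum>k\<in>snd ` D. (Poly_Mapping.lookup P (t k) \<circ>\<^sub>p iter_poly (n - k)) *
        (\<Prod>j<k. iter_poly (n - j) - iter_poly 0))"
      by (simp add: t_def)
    also have "\<dots> \<noteq> 0"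
    proof (rule word_entries_nonzero[OF f])
      fix k assume "k \<in> snd ` D"
      then obtain u where "u \<in> D" "k = snd u" by blast
      then show "Poly_Mapping.lookup P (t k) \<noteq> 0"
        using t by (simp add: D_def in_keys_iff)
    qed (use D n in auto)
    finally show "\<exists>i. int i = int n + m \<and> coeff (app (endo.nf model_x model_h model_y P) (monom 1 n)) i \<noteq> 0"
      using l by blast
  qed
  then show ?thesis ..
qed

lemma nf_eq_0_iff:
  assumes "degree f > 1"
  shows "endo.nf model_x model_h model_y P = 0 \<longleftrightarrow> P = 0"
  using nf_shifts_degree[OF assms, of P] shifts_degree_nonzero by auto

text \<open>Degree shifts add under composition; this is how the algebra turns out to be a
  domain.\<close>

lemma nf_mult_nonzero:
  assumes "degree f > 1" "P \<noteq> 0" "Q \<noteq> 0"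
  shows "endo.nf model_x model_h model_y P * endo.nf model_x model_h model_y Q \<noteq> 0"
proof -
  obtain m n where "shifts_degree (endo.nf model_x model_h model_y P) m" "shifts_degree (endo.nf model_x model_h model_y Q) n"
    using nf_shifts_degree[OF assms(1)] assms(2,3) by metis
  then show ?thesis
    by (rule shifts_degree_nonzero[OF shifts_degree_mult])
qed

section \<open>Operators intertwining polynomials in h\<close>

lemma iter_poly_inj:
  assumes "degree f > 1" "iter_poly m = iter_poly n"
  shows "m = n"
proof -
  have "degree f ^ m = degree f ^ n"
    using assms(2) by (metis degree_iter_poly)
  with assms(1) show ?thesis by simp
qed

lemma coeff_app_peval_h:
  "coeff (app (endo.peval p model_h) v) i = coeff v i * (p \<circ>\<^sub>p iter_poly i)"
proof -
  have "app (endo.peval p model_h) v = (\<Sum>n\<le>degree v. monom (coeff v n * (p \<circ>\<^sub>p iter_poly n)) n)"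
    using app_peval_h[of p 1] by (simp add: app_eq_sum[of _ v] smult_monom)
  then have "coeff (app (endo.peval p model_h) v) i = 
      (\<Sum>n\<le>degree v. if i = n then coeff v n * (p \<circ>\<^sub>p iter_poly n) else 0)"
    by (auto simp: coeff_sum intro!: sum.cong)
  then show ?thesis
    by (simp add: coeff_eq_0)
qed

text \<open>Polynomials in h act diagonally, so the relation makes the entry of \<open>u\<close>
  from n to i vanish after multiplication by the difference of two diagonal entries. These are
  elements of the domain \<complex>[h].\<close>

lemma intertwiner_entries:
  assumes "endo.peval p model_h * u = u * endo.peval q model_h" "p \<circ>\<^sub>p iter_poly i \<noteq> q \<circ>\<^sub>p iter_poly n"
  shows "coeff (app u (monom 1 n)) i = 0"
proof -
  have "app u (app (endo.peval q model_h) (monom 1 n)) = Polynomial.smult (q \<circ>\<^sub>p iter_poly n) (app u (monom 1 n))"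
    using app_peval_h[of q 1 n] by (metis app_smult_right mult.right_neutral mult_1 smult_monom)
  then have "coeff (app u (monom 1 n)) i * (p \<circ>\<^sub>p iter_poly i) = (q \<circ>\<^sub>p iter_poly n) * coeff (app u (monom 1 n)) i"
    using arg_cong[OF assms(1), of "\<lambda>a. coeff (app a (monom 1 n)) i"] by (simp add: coeff_app_peval_h)
  then have "coeff (app u (monom 1 n)) i * (p \<circ>\<^sub>p iter_poly i - q \<circ>\<^sub>p iter_poly n) = 0"
    by (simp add: algebra_simps)
  with assms(2) show ?thesis by simp
qed

text \<open>The iterates of \<open>f\<close> have distinct degrees, so the diagonal entries of the
  two sides agree only for i = n + k.\<close>

lemma homogeneous_raising:
  assumes f: "degree f > 1" and u: "model_h * u = u * endo.peval (iter_poly k) model_h"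
  obtains \<alpha> where "\<And>q n. app u (monom q n) = monom (q * \<alpha> n) (n + k)"
proof
  fix q n
  have "coeff (app u (monom 1 n)) i = 0" if "i \<noteq> n + k" for i
  proof (rule intertwiner_entries[of "[:0, 1:]" u "iter_poly k"])
    show "[:0, 1:] \<circ>\<^sub>p iter_poly i \<noteq> iter_poly k \<circ>\<^sub>p iter_poly n"
      using that iter_poly_inj[OF f, of i "n + k"] iter_poly_add[of k n] by (auto simp: pcompose_pCons add.commute)
  qed (simp add: u)
  then have "app u (monom 1 n) = monom (coeff (app u (monom 1 n)) (n + k)) (n + k)"
    by (simp add: poly_eq_iff)
  then have "Polynomial.smult q (app u (monom 1 n)) = monom (q * coeff (app u (monom 1 n)) (n + k)) (n + k)"
    by (metis smult_monom)
  then show "app u (monom q n) = monom (q * coeff (app u (monom 1 n)) (n + k)) (n + k)"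
    by (simp add: smult_monom flip: app_smult_right)
qed

text \<open>Now the diagonal entries agree only for n = i + 1. No i satisfies this for n = 0, so
  constants are killed.\<close>

lemma homogeneous_lowering:
  assumes f: "degree f > 1" and w: "w * model_h = endo.peval f model_h * w"
  obtains \<beta> where "\<And>q. app w (monom q 0) = 0" "\<And>q n. app w (monom q (Suc n)) = monom (q * \<beta> n) n"
proof
  have entry: "coeff (app w (monom 1 n)) i = 0" if "n \<noteq> Suc i" for n i
  proof (rule intertwiner_entries[of f w "[:0, 1:]"])
    show "f \<circ>\<^sub>p iter_poly i \<noteq> [:0, 1:] \<circ>\<^sub>p iter_poly n"
      using that iter_poly_inj[OF f, of n "Suc i"] by (auto simp: pcompose_pCons iter_poly.simps)
  qed (simp add: w)
  have "app w (monom 1 0) = 0"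
    using entry[of 0] by (simp only: poly_eq_iff) simp
  then show "app w (monom q 0) = 0" for q
    using app_smult_right[of w q "monom 1 0"] by (simp only: smult_monom mult_1_right smult_0_right)
  fix q n
  have "app w (monom 1 (Suc n)) = monom (coeff (app w (monom 1 (Suc n))) n) n"
    using entry[of "Suc n"] by (simp add: poly_eq_iff)
  then have "Polynomial.smult q (app w (monom 1 (Suc n))) = monom (q * coeff (app w (monom 1 (Suc n))) n) n"
    by (metis smult_monom)
  then show "app w (monom q (Suc n)) = monom (q * coeff (app w (monom 1 (Suc n))) n) n"
    by (simp add: smult_monom flip: app_smult_right)
qed

end

section \<open>Derivations of the represented algebra\<close>

locale model_derivation = domain_lf_derivation endo_sc S \<delta>
  for S \<delta> +
  fixes f :: "complex poly"
  assumes degree_f: "degree f > 1"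
    and x_S [simp]: "model_x \<in> S" and h_S [simp]: "model_h f \<in> S" and y_S [simp]: "model_y f \<in> S"
    and S_nf: "a \<in> S \<Longrightarrow> \<exists>P. a = endo.nf model_x (model_h f) (model_y f) P"
begin

abbreviation "x \<equiv> model_x"
abbreviation "h \<equiv> model_h f"
abbreviation "y \<equiv> model_y f"

lemma x_power_nonzero: "x ^ n \<noteq> 0"
proof
  assume "x ^ n = 0"
  then have "app (x ^ n) (monom 1 0) = 0" by simp
  then show False by (simp only: app_model_x_power) (simp add: monom_eq_0_iff)
qed

lemma \<delta>_h: "\<delta> h = 0"
  using x_power_nonzero[of 1] by (intro intertwiner_constant[of x h f] degree_f model_hx) simp_all

lemma \<delta>_peval_h [simp]: "\<delta> (peval p h) = 0"
  by (intro \<delta>_peval_0 \<delta>_h h_S)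

lemma h_x_power: "h * x ^ k = x ^ k * peval (iter_poly f k) h"
  by (rule lin_endo_monom_eqI) (simp add: iter_poly_add add.commute[of _ k])

text \<open>As \<delta> kills h and its polynomials, applying it to \<open>h_x_power\<close> shows
  that \<delta>(x^k) commutes with h in the same way as x^k.\<close>

lemma \<delta>_x_power_raising:
  obtains \<alpha> where "\<And>q n. app (\<delta> (x ^ k)) (monom q n) = monom (q * \<alpha> n) (n + k)"
proof -
  have "\<delta> (h * x ^ k) = \<delta> (x ^ k * peval (iter_poly f k) h)"
    by (simp only: h_x_power)
  then have "h * \<delta> (x ^ k) = \<delta> (x ^ k) * peval (iter_poly f k) h"
    by (simp add: \<delta>_mult \<delta>_h)
  from homogeneous_raising[OF degree_f this] that show ?thesis
    by blast
qed

lemma \<delta>_y_lowering: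
  obtains \<beta> where "\<And>q. app (\<delta> y) (monom q 0) = 0"
    "\<And>q n. app (\<delta> y) (monom q (Suc n)) = monom (q * \<beta> n) n"
proof -
  have "\<delta> (y * h) = \<delta> (peval f h * y)"
    by (simp only: model_yh)
  then have "\<delta> y * h = peval f h * \<delta> y"
    by (simp add: \<delta>_mult \<delta>_h)
  from homogeneous_lowering[OF degree_f this] that show ?thesis
    by blast
qed

text \<open>The diagonal entries \<open>t n\<close> of \<open>\<delta> (x y) = \<delta> (y x)\<close> satisfy \<open>t 0 = 0\<close> when computed from
  \<open>x y\<close>, and the entry at \<open>n\<close> computed from \<open>y x\<close> is the entry at \<open>n + 1\<close> computed from \<open>x y\<close>.\<close>

lemma \<delta>_xy: "\<delta> (x * y) = 0"
proof -
  obtain \<alpha> where \<alpha>: "\<And>q n. app (\<delta> x) (monom q n) = monom (q * \<alpha> n) (Suc n)"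
    using \<delta>_x_power_raising[of 1] by auto
  obtain \<beta> where \<beta>: "\<And>q. app (\<delta> y) (monom q 0) = 0"
      "\<And>q n. app (\<delta> y) (monom q (Suc n)) = monom (q * \<beta> n) n"
    using \<delta>_y_lowering by blast
  have "\<delta> (y * x - x * y) = 0"
    unfolding model_yx by (simp add: \<delta>_diff \<delta>_h)
  then have yx: "\<delta> (y * x) = \<delta> (x * y)"
    by (simp add: \<delta>_diff)
  define t where "t n = \<alpha> n * (iter_poly f (Suc n) - iter_poly f 0) + \<beta> n" for n
  have yx_entry: "app (\<delta> (y * x)) (monom q n) = monom (q * t n) n" for q n
    by (simp add: \<delta>_mult \<alpha> \<beta> t_def add_monom algebra_simps)
  have xy_entry: "app (\<delta> (x * y)) (monom q (Suc n)) = monom (q * t n) (Suc n)" for q n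
    by (simp add: \<delta>_mult \<alpha> \<beta> t_def add_monom algebra_simps)
  have "t n = 0" for n
  proof (induction n)
    case 0
    have "app (\<delta> (x * y)) (monom 1 0) = 0"
      by (simp only: \<delta>_mult x_S y_S app_plus app_times \<beta> app_model_y_0 app_0_right add_0)
    then have "monom (1 * t 0) 0 = 0"
      by (simp only: yx_entry flip: yx)
    then show ?case by (simp add: monom_eq_0_iff)
  next
    case (Suc n)
    have "monom (1 * t (Suc n)) (Suc n) = monom (1 * t n) (Suc n)"
      by (simp only: yx_entry[symmetric] xy_entry[symmetric] yx)
    with Suc show ?case by (simp add: monom_eq_iff')
  qed
  then have "\<delta> (y * x) = 0"
    by (intro lin_endo_monom_eqI) (simp add: yx_entry)
  then show ?thesis by (simp add: yx)
qed

text \<open>Moving one \<open>y\<close> through \<open>x ^ Suc k\<close> splits off the right factor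
  \<open>?c\<close>, a combination of x y and polynomials in h, all killed by \<delta>.\<close>

lemma \<delta>_yk_xk: "\<delta> (y ^ k * x ^ k) = 0"
proof (induction k)
  case (Suc k)
  let ?c = "(x * y - h) + peval (iter_poly f (Suc k)) h"
  have "y * (x * x ^ k) = x ^ k * ?c"
  proof (rule lin_endo_monom_eqI)
    fix q n
    show "app (y * (x * x ^ k)) (monom q n) = app (x ^ k * ?c) (monom q n)"
      using iter_poly_add[of f "Suc k" "n"]
      by (cases n) (simp_all add: add_monom diff_monom app_add_right algebra_simps iter_poly_add flip: monom_0)
  qed
  then have "y ^ Suc k * x ^ Suc k = (y ^ k * x ^ k) * ?c"
    by (simp only: power_Suc2[of y] power_Suc[of x] mult.assoc)
  moreover have "\<delta> ?c = 0"
    by (simp add: \<delta>_add \<delta>_diff \<delta>_xy \<delta>_h)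
  ultimately show ?case
    using Suc by (simp add: \<delta>_mult del: power_Suc)
qed simp

text \<open>Differentiate b x^k = x^k g, where g = p(h) y^k x^k is killed by \<delta>. The terms b
  \<delta>(x^k) and \<delta>(x^k) g agree because \<delta>(x^k) shifts the basis as x^k does; so
  \<delta>(b) x^k = 0, and x^k cancels in a domain.\<close>

lemma \<delta>_balanced_word: "\<delta> (x ^ k * peval p h * y ^ k) = 0"
proof -
  let ?b = "x ^ k * peval p h * y ^ k" and ?g = "peval p h * (y ^ k * x ^ k)"
  \<comment> \<open>\<open>\<gamma> n\<close> is the diagonal entry of \<open>?b\<close> at n + k
    and also that of \<open>?g\<close> at n.\<close>
  define \<gamma> where "\<gamma> n = (p \<circ>\<^sub>p iter_poly f n) * (\<Prod>j<k. iter_poly f (n + k - j) - iter_poly f 0)" for n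
  have b: "app ?b (monom q (n + k)) = monom (q * \<gamma> n) (n + k)" for q n
    by (simp add: app_model_y_power \<gamma>_def mult_ac)
  have g: "app ?g (monom q n) = monom (q * \<gamma> n) n" for q n
    by (simp add: app_model_y_power \<gamma>_def mult_ac)
  obtain \<alpha> where \<alpha>: "\<And>q n. app (\<delta> (x ^ k)) (monom q n) = monom (q * \<alpha> n) (n + k)"
    using \<delta>_x_power_raising[of k] by blast
  have "?b * \<delta> (x ^ k) = \<delta> (x ^ k) * ?g"
    by (rule lin_endo_monom_eqI) (simp only: app_times[of ?b] app_times[of "\<delta> (x ^ k)"] \<alpha> b g, simp add: mult_ac)
  moreover have "\<delta> (?b * x ^ k) = \<delta> (x ^ k * ?g)"
    by (simp only: mult.assoc)
  moreover have "\<delta> ?g = 0"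
    by (simp add: \<delta>_mult[of "peval p h"] \<delta>_yk_xk)
  ultimately have "\<delta> ?b * x ^ k = 0"
    by (simp add: \<delta>_mult[of ?b] \<delta>_mult[of "x ^ k" ?g])
  then show ?thesis
    using no_zero_div[of "\<delta> ?b" "x ^ k"] x_power_nonzero by simp
qed

text \<open>Since \<delta> x raises the basis by one, only words x^(k+1) q(h) y^k survive in its
  normal form. Splitting off one x on the left leaves balanced words.\<close>

lemma \<delta>_x_eq:
  obtains a where "a \<in> S" "\<delta> a = 0" "\<delta> x = x * a"
proof -
  obtain P where P: "\<delta> x = nf x h y P"
    using S_nf[of "\<delta> x"] by auto
  let ?K = "Poly_Mapping.keys P"
  let ?L = "Poly_Mapping.lookup P"
  define D where "D = {t \<in> ?K. fst t = Suc (snd t)}"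
  obtain \<alpha> where \<alpha>: "\<And>q n. app (\<delta> x) (monom q n) = monom (q * \<alpha> n) (Suc n)"
    using \<delta>_x_power_raising[of 1] by auto
  have D: "\<delta> x = (\<Sum>t\<in>D. nf_word x h y t (?L t))"
  proof (rule lin_endo_eqI, rule poly_eqI)
    fix n i
    let ?c = "\<lambda>t. coeff (app (nf_word x h y t (?L t)) (monom 1 n)) i"
    have "coeff (app (\<delta> x) (monom 1 n)) i = (\<Sum>t\<in>?K. ?c t)"
      by (simp only: P nf_def app_sum coeff_sum)
    moreover have "coeff (app (\<delta> x) (monom 1 n)) i = 0" if "i \<noteq> Suc n"
      using that by (simp only: \<alpha>) simp
    ultimately have "coeff (app (\<delta> x) (monom 1 n)) i = (if i = Suc n then (\<Sum>t\<in>?K. ?c t) else 0)"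
      by metis
    also have "\<dots> = (\<Sum>t\<in>D. ?c t)"
    proof (cases "i = Suc n")
      case True
      have "(\<Sum>t\<in>?K. ?c t) = (\<Sum>t\<in>D. ?c t)"
        by (rule sum.mono_neutral_right) (auto simp: D_def app_nf_word True)
      with True show ?thesis by simp
    next
      case False
      then have "?c t = 0" if "t \<in> D" for t
        using that by (auto simp: D_def app_nf_word)
      with False show ?thesis by simp
    qed
    finally show "coeff (app (\<delta> x) (monom 1 n)) i =
        coeff (app (\<Sum>t\<in>D. nf_word x h y t (?L t)) (monom 1 n)) i"
      by (simp add: app_sum coeff_sum)
  qed
  define a where "a = (\<Sum>t\<in>D. x ^ snd t * peval (?L t) h * y ^ snd t)"
  have "\<delta> x = x * a"
    unfolding D a_def sum_distrib_left by (intro sum.cong) (auto simp: D_def nf_word_def mult.assoc)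
  moreover have "a \<in> S"
    unfolding a_def by (intro S_sum) simp
  moreover have "\<delta> a = 0"
    unfolding a_def by (subst \<delta>_sum) (simp_all add: \<delta>_balanced_word)
  ultimately show ?thesis
    using that by blast
qed

text \<open>For \<open>c\<close> killed by \<delta>, (\<delta> - l)(x c) = x (a - l) c. A vanishing
  product of such operators thus gives a vanishing product of x, c and factors a - l, one of which
  must be zero. The factor \<open>c\<close> collects those already processed.\<close>

lemma dls_x_mult:
  assumes "a \<in> S" "\<delta> a = 0" "\<delta> x = x * a" "c \<in> S" "\<delta> c = 0" "c \<noteq> 0" "dls ls (x * c) = 0"
  shows "\<exists>l. a = endo_sc l"
  using assms(4-)
proof (induction ls arbitrary: c)
  case Nil
  then show ?case
    using no_zero_div[of x c] x_power_nonzero[of 1] by simp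
next
  case (Cons l ls)
  have eq: "dl l (x * c) = x * ((a - endo_sc l) * c)"
    using Cons.prems assms by (simp add: dl_def \<delta>_mult algebra_simps sc_left_comm)
  show ?case
  proof (cases "(a - endo_sc l) * c = 0")
    case True
    then have "a - endo_sc l = 0"
      using Cons.prems assms no_zero_div[of "a - endo_sc l" c] by simp
    then show ?thesis by auto
  next
    case False
    with Cons.prems assms eq show ?thesis
      by (intro Cons.IH[of "(a - endo_sc l) * c"]) (simp_all add: \<delta>_mult \<delta>_diff)
  qed
qed

theorem \<delta>_scaling:
  obtains l where "\<delta> x = endo_sc l * x" "\<delta> y = - (endo_sc l * y)" "\<delta> h = 0"
proof -
  obtain a where a: "a \<in> S" "\<delta> a = 0" "\<delta> x = x * a"
    by (rule \<delta>_x_eq)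
  obtain A where "x \<in> geig A"
    using geig_finite x_S by blast
  then obtain ls where "dls ls (x * 1) = 0"
    by (metis geigE mult.right_neutral)
  then obtain l where "a = endo_sc l"
    using dls_x_mult[OF a, of 1 ls] by auto
  then have x: "\<delta> x = endo_sc l * x"
    using a(3) by (simp add: sc_comm)
  \<comment> \<open>This is \<delta>(x y) = 0 expanded; cancelling x determines \<delta> y.\<close>
  have "x * (endo_sc l * y + \<delta> y) = 0"
    using \<delta>_xy x by (simp add: \<delta>_mult algebra_simps sc_left_comm)
  then have "endo_sc l * y + \<delta> y = 0"
    using no_zero_div[of x "endo_sc l * y + \<delta> y"] x_power_nonzero[of 1] by simp
  then have "\<delta> y = - (endo_sc l * y)"
    by (simp add: add_eq_0_iff)
  with x \<delta>_h show ?thesis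
    using that by blast
qed

end

section \<open>Normal forms in the presented algebra\<close>

text \<open>The relations are taken modulo an ideal \<open>I\<close>, so that the rewriting happens
  in the free algebra itself and not among cosets.\<close>

locale heis_relations = central_scalars sc
  for sc :: "complex \<Rightarrow> 'r::ring_1" +
  fixes I :: "'r set" and x y h :: 'r and f :: "complex poly"
  assumes I_0: "0 \<in> I" and I_add: "u \<in> I \<Longrightarrow> v \<in> I \<Longrightarrow> u + v \<in> I"
    and I_lmult: "u \<in> I \<Longrightarrow> v * u \<in> I" and I_rmult: "u \<in> I \<Longrightarrow> u * v \<in> I"
    and hx: "h * x - x * peval f h \<in> I"
    and yh: "y * h - peval f h * y \<in> I"
    and yx: "(y * x - x * y) - (peval f h - h) \<in> I"
begin

lemma I_minus: "u \<in> I \<Longrightarrow> - u \<in> I"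
  using I_lmult[of u "- 1"] by simp

lemma I_diff: "u \<in> I \<Longrightarrow> v \<in> I \<Longrightarrow> u - v \<in> I"
  using I_add[of u "- v"] by (simp add: I_minus)

lemma intertwine_mod: "a * b - b * c \<in> I \<Longrightarrow> peval p a * b - b * peval p c \<in> I"
  by (rule peval_intertwine_mod) (simp_all add: I_0 I_add I_lmult I_rmult)

lemma hx_power: "h * x ^ i - x ^ i * peval (iter_poly f i) h \<in> I"
proof (induction i)
  case 0
  then show ?case by (simp add: iter_poly.simps(1) I_0)
next
  case (Suc i)
  have "peval f h * x ^ i - x ^ i * peval f (peval (iter_poly f i) h) \<in> I"
    by (rule intertwine_mod[OF Suc])
  then have "(h * x - x * peval f h) * x ^ i + x * (peval f h * x ^ i - x ^ i * peval f (peval (iter_poly f i) h)) \<in> I"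
    by (intro I_add I_rmult[OF hx] I_lmult)
  then show ?case
    by (simp add: iter_poly.simps(2) peval_pcompose algebra_simps)
qed

lemma y_peval: "y * peval q h - peval (q \<circ>\<^sub>p f) h * y \<in> I"
proof -
  have *: "peval f h * y - y * h \<in> I"
    using I_minus[OF yh] by simp
  have "peval q (peval f h) * y - y * peval q h \<in> I"
    by (rule intertwine_mod[OF *])
  then show ?thesis
    using I_minus by (fastforce simp: peval_pcompose)
qed

text \<open>Stating this for \<open>Suc i\<close> lets the lower power x^i appear without a
  truncated subtraction.\<close>

lemma yx_power:
  "y * x ^ Suc i - x ^ Suc i * y - x ^ i * (peval (iter_poly f (Suc i)) h - h) \<in> I"
proof (induction i)
  case 0
  then show ?case using yx by (simp add: iter_poly.simps)
next
  case (Suc i)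
  let ?p = "\<lambda>i. peval (iter_poly f i) h"
  have "?p (Suc i) * x - x * peval (iter_poly f (Suc i)) (peval f h) \<in> I"
    by (rule intertwine_mod[OF hx])
  moreover have "peval (iter_poly f (Suc i)) (peval f h) = ?p (Suc (Suc i))"
    using iter_poly_add[of f "Suc i" 1] by (simp add: peval_pcompose[symmetric] iter_poly.simps(1) iter_poly.simps(2)[of f 0])
  ultimately have R: "?p (Suc i) * x - x * ?p (Suc (Suc i)) \<in> I"
    by simp
  \<comment> \<open>The induction hypothesis is multiplied by x on the right. The terms x^(i+1) y x,
    x^i h x, x^(i+1) f(h) and the iterate still to the left of x cancel in the sum.\<close>
  have "(y * x ^ Suc i - x ^ Suc i * y - x ^ i * (?p (Suc i) - h)) * x +
      x ^ Suc i * ((y * x - x * y) - (peval f h - h)) +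
      (x ^ i * (?p (Suc i) * x - x * ?p (Suc (Suc i))) - x ^ i * (h * x - x * peval f h)) \<in> I"
    by (rule I_add[OF I_add[OF I_rmult[OF Suc] I_lmult[OF yx]] I_diff[OF I_lmult[OF R] I_lmult[OF hx]]])
  then show ?case
    by (simp add: power_Suc2 algebra_simps del: power_Suc)
qed

text \<open>Only existence is at stake here; uniqueness is read off the representation.\<close>

definition has_nf :: "'r \<Rightarrow> bool" where
  "has_nf u \<longleftrightarrow> (\<exists>P. u - nf x h y P \<in> I)"

lemma has_nf_word: "has_nf (nf_word x h y t q)"
  unfolding has_nf_def by (rule exI[of _ "Poly_Mapping.single t q"]) (simp add: nf_single I_0)

lemma has_nf_0: "has_nf 0"
  using has_nf_word[of _ 0] by simp

lemma has_nf_add: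
  assumes "has_nf u" "has_nf v"
  shows "has_nf (u + v)"
proof -
  obtain P Q where "u - nf x h y P \<in> I" "v - nf x h y Q \<in> I"
    using assms unfolding has_nf_def by blast
  then have "(u - nf x h y P) + (v - nf x h y Q) \<in> I"
    by (rule I_add)
  then have "u + v - nf x h y (P + Q) \<in> I"
    by (simp add: nf_add algebra_simps)
  then show ?thesis
    unfolding has_nf_def by blast
qed

lemma has_nf_sum: "(\<And>i. i \<in> A \<Longrightarrow> has_nf (g i)) \<Longrightarrow> has_nf (sum g A)"
  by (induction A rule: infinite_finite_induct) (simp_all add: has_nf_add has_nf_0)

lemma has_nf_cong:
  assumes "u - v \<in> I" "has_nf v"
  shows "has_nf u"
proof -
  obtain P where "v - nf x h y P \<in> I"
    using assms(2) unfolding has_nf_def by blast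
  with assms(1) have "(u - v) + (v - nf x h y P) \<in> I"
    by (rule I_add)
  then have "u - nf x h y P \<in> I"
    by simp
  then show ?thesis
    unfolding has_nf_def by blast
qed

text \<open>Words of the free algebra grow by a generator on the left, so stability under left
  multiplication is what matters, and by linearity it can be tested on normally ordered
  words.\<close>

lemma has_nf_left_mult:
  assumes "\<And>t q. has_nf (g * nf_word x h y t q)" "has_nf u"
  shows "has_nf (g * u)"
proof -
  obtain P where P: "u - nf x h y P \<in> I"
    using assms(2) unfolding has_nf_def by blast
  have "g * u - g * nf x h y P \<in> I"
    using I_lmult[OF P, of g] by (simp add: right_diff_distrib)
  moreover have "has_nf (g * nf x h y P)"
    unfolding nf_def sum_distrib_left by (intro has_nf_sum assms(1))
  ultimately show ?thesis
    by (rule has_nf_cong)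
qed

lemma has_nf_sc: "has_nf u \<Longrightarrow> has_nf (sc c * u)"
proof (rule has_nf_left_mult)
  fix t :: "nat \<times> nat" and q :: "complex poly"
  have "sc c * nf_word x h y t q = nf_word x h y t (Polynomial.smult c q)"
    by (simp add: nf_word_def peval_smult mult.assoc sc_left_comm)
  then show "has_nf (sc c * nf_word x h y t q)"
    by (simp add: has_nf_word)
qed

lemma has_nf_x: "has_nf u \<Longrightarrow> has_nf (x * u)"
proof (rule has_nf_left_mult)
  fix t :: "nat \<times> nat" and q :: "complex poly"
  have "x * nf_word x h y t q = nf_word x h y (Suc (fst t), snd t) q"
    by (simp add: nf_word_def mult.assoc)
  then show "has_nf (x * nf_word x h y t q)"
    by (simp add: has_nf_word)
qed

lemma has_nf_h: "has_nf u \<Longrightarrow> has_nf (h * u)"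
proof (rule has_nf_left_mult)
  fix t :: "nat \<times> nat" and q :: "complex poly"
  let ?i = "fst t" and ?k = "snd t"
  have "(h * x ^ ?i - x ^ ?i * peval (iter_poly f ?i) h) * (peval q h * y ^ ?k) \<in> I"
    by (rule I_rmult[OF hx_power])
  then have "h * nf_word x h y t q - nf_word x h y t (iter_poly f ?i * q) \<in> I"
    by (simp add: nf_word_def peval_mult left_diff_distrib mult.assoc)
  then show "has_nf (h * nf_word x h y t q)"
    using has_nf_word by (rule has_nf_cong)
qed

text \<open>Passing y through x^i leaves x^i y and a correction with x^(i-1), absent for i = 0. In
  the first term y then passes q(h) and turns it into q(f(h)).\<close>

lemma has_nf_y: "has_nf u \<Longrightarrow> has_nf (y * u)"
proof (rule has_nf_left_mult)
  fix t :: "nat \<times> nat" and q :: "complex poly"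
  obtain i k where t: "t = (i, k)" by force
  let ?r = "(y * peval q h - peval (q \<circ>\<^sub>p f) h * y) * y ^ k"
  have r: "x ^ i * ?r \<in> I"
    by (rule I_lmult[OF I_rmult[OF y_peval]])
  show "has_nf (y * nf_word x h y t q)"
  proof (cases i)
    case 0
    have "y * nf_word x h y t q - nf_word x h y (0, Suc k) (q \<circ>\<^sub>p f) \<in> I"
      using r by (simp add: t 0 nf_word_def algebra_simps)
    then show ?thesis
      using has_nf_word by (rule has_nf_cong)
  next
    case (Suc j)
    let ?L = "(y * x ^ Suc j - x ^ Suc j * y - x ^ j * (peval (iter_poly f (Suc j)) h - h)) * (peval q h * y ^ k) + x ^ i * ?r"
    have "?L = y * (x ^ i * peval q h * y ^ k) - (x ^ i * peval (q \<circ>\<^sub>p f) h * y ^ Suc k +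
        x ^ j * ((peval (iter_poly f i) h - h) * peval q h) * y ^ k)"
      by (simp add: Suc algebra_simps)
    also have "(peval (iter_poly f i) h - h) * peval q h = peval ((iter_poly f i - [:0, 1:]) * q) h"
      by (simp only: peval_mult peval_diff peval_X)
    finally have "?L = y * nf_word x h y t q -
        (nf_word x h y (i, Suc k) (q \<circ>\<^sub>p f) + nf_word x h y (j, k) ((iter_poly f i - [:0, 1:]) * q))"
      by (simp only: t nf_word_def fst_conv snd_conv)
    moreover have "?L \<in> I"
      by (rule I_add[OF I_rmult[OF yx_power] r])
    ultimately have "y * nf_word x h y t q -
        (nf_word x h y (i, Suc k) (q \<circ>\<^sub>p f) + nf_word x h y (j, k) ((iter_poly f i - [:0, 1:]) * q)) \<in> I"
      by (simp only:)
    then show ?thesis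
      by (rule has_nf_cong) (intro has_nf_add has_nf_word)
  qed
qed

end

section \<open>The free algebra and its evaluations\<close>

lemma poly_mapping_single_induct:
  fixes p :: "'a \<Rightarrow>\<^sub>0 'b::comm_monoid_add"
  assumes single: "\<And>k c. Q (Poly_Mapping.single k c)" and add: "\<And>p q. Q p \<Longrightarrow> Q q \<Longrightarrow> Q (p + q)"
  shows "Q p"
proof -
  have sum: "Q (\<Sum>k\<in>A. Poly_Mapping.single k (Poly_Mapping.lookup p k))" if "finite A" for A
    using that
  proof (induction A)
    case empty
    then show ?case using single[of undefined 0] by simp
  qed (simp add: single add)
  have "p = (\<Sum>k\<in>Poly_Mapping.keys p. Poly_Mapping.single k (Poly_Mapping.lookup p k))"
    by (rule poly_mapping_eqI) (auto simp: lookup_sum lookup_single when_def in_keys_iff)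
  then show ?thesis
    using sum[of "Poly_Mapping.keys p"] by simp
qed

context central_scalars
begin

definition word_eval :: "('g \<Rightarrow> 'r) \<Rightarrow> 'g free_monoid \<Rightarrow> 'r" where
  "word_eval g w = prod_list (map g (letters w))"

definition free_eval :: "('g \<Rightarrow> 'r) \<Rightarrow> 'g free_alg \<Rightarrow> 'r" where
  "free_eval g p = (\<Sum>w\<in>Poly_Mapping.keys p. sc (Poly_Mapping.lookup p w) * word_eval g w)"

lemma word_eval_add: "word_eval g (v + w) = word_eval g v * word_eval g w"
  by (simp add: word_eval_def plus_free_monoid_def)

lemma word_eval_0 [simp]: "word_eval g 0 = 1"
  by (simp add: word_eval_def zero_free_monoid_def)

lemma free_eval_superset:
  assumes "finite A" "Poly_Mapping.keys p \<subseteq> A"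
  shows "free_eval g p = (\<Sum>w\<in>A. sc (Poly_Mapping.lookup p w) * word_eval g w)"
  unfolding free_eval_def using assms
  by (intro sum.mono_neutral_left) (auto simp: in_keys_iff)

lemma free_eval_single: "free_eval g (Poly_Mapping.single w c) = sc c * word_eval g w"
  by (simp add: free_eval_def)

lemma free_eval_add: "free_eval g (p + q) = free_eval g p + free_eval g q"
proof -
  let ?A = "Poly_Mapping.keys p \<union> Poly_Mapping.keys q"
  have "free_eval g (p + q) = (\<Sum>w\<in>?A. sc (Poly_Mapping.lookup (p + q) w) * word_eval g w)"
    by (rule free_eval_superset) (simp_all add: Poly_Mapping.keys_add)
  then show ?thesis
    by (simp add: free_eval_superset[of ?A] lookup_add sc_add distrib_right sum.distrib)
qed

lemma free_eval_mult: "free_eval g (p * q) = free_eval g p * free_eval g q"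
proof (induction p rule: poly_mapping_single_induct)
  case (1 v c)
  show ?case
  proof (induction q rule: poly_mapping_single_induct)
    case (1 w d)
    have "sc (c * d) * (word_eval g v * word_eval g w) = sc c * (word_eval g v * (sc d * word_eval g w))"
      by (simp add: sc_mult mult.assoc sc_left_comm[of "word_eval g v"])
    then show ?case
      by (simp add: mult_single free_eval_single word_eval_add mult.assoc)
  qed (simp add: distrib_left free_eval_add)
qed (simp add: distrib_right free_eval_add)

lemma free_eval_sc [simp]: "free_eval g (Poly_Mapping.single 0 c) = sc c"
  by (simp add: free_eval_single)

lemma free_eval_gen [simp]: "free_eval g (free_gen a) = g a"
  by (simp add: free_gen_def free_eval_single word_eval_def)

lemma free_eval_0 [simp]: "free_eval g 0 = 0"
  by (simp add: free_eval_def)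

lemma free_eval_1 [simp]: "free_eval g 1 = 1"
  using free_eval_sc[of g 1] by simp

lemma free_eval_diff: "free_eval g (p - q) = free_eval g p - free_eval g q"
  using free_eval_add[of g "p - q" q] by simp

lemma free_eval_power: "free_eval g (p ^ n) = free_eval g p ^ n"
  by (induction n) (simp_all add: free_eval_mult)

lemma free_eval_sum: "free_eval g (sum p A) = (\<Sum>i\<in>A. free_eval g (p i))"
  by (induction A rule: infinite_finite_induct) (simp_all add: free_eval_add)

end

text \<open>With the free algebra as an instance, \<open>poly_in_h\<close> is a
  \<open>peval\<close>, and normal forms can be written before they are evaluated.\<close>

interpretation free: central_scalars "Poly_Mapping.single 0 :: complex \<Rightarrow> 'g free_alg"
proof
  show "Poly_Mapping.single 0 1 = (1 :: 'g free_alg)" by simp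
  show "Poly_Mapping.single 0 (c + d) = Poly_Mapping.single 0 c + (Poly_Mapping.single 0 d :: 'g free_alg)" for c d
    by (rule single_add)
  show "Poly_Mapping.single 0 (c * d) = Poly_Mapping.single 0 c * (Poly_Mapping.single 0 d :: 'g free_alg)" for c d
    by (rule single_0_mult)
  show "Poly_Mapping.single 0 c * p = p * (Poly_Mapping.single 0 c :: 'g free_alg)" for c p
    by (induction p rule: poly_mapping_single_induct) (simp_all add: mult_single mult.commute distrib_left distrib_right)
qed

lemma poly_in_h_eq_peval: "poly_in_h f = free.peval f (free_gen GH)"
  by (simp add: poly_in_h_def free.peval_def)

lemma (in central_scalars) free_eval_peval:
  "free_eval g (free.peval p a) = peval p (free_eval g a)"
  by (simp add: free.peval_def peval_def free_eval_sum free_eval_mult free_eval_power)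

lemma (in central_scalars) free_eval_nf:
  "free_eval g (free.nf x h y P) = nf (free_eval g x) (free_eval g h) (free_eval g y) P"
  by (simp add: free.nf_def nf_def free.nf_word_def nf_word_def free_eval_sum free_eval_mult
      free_eval_power free_eval_peval)

lemma (in central_scalars) ideal_ker_free_eval:
  fixes g :: "'g \<Rightarrow> 'r"
  shows "ideal {p. free_eval g p = 0} free_algebra"
proof -
  interpret F: ring "free_algebra :: (complex, 'g free_alg) module"
    by (rule ring_free_algebra)
  have inv: "inv\<^bsub>add_monoid free_algebra\<^esub> p = - p" for p :: "'g free_alg"
    using F.minus_equality[of "- p" p] by (simp add: free_algebra_def a_inv_def)
  show ?thesis
  proof (rule idealI[OF ring_free_algebra])
    show "subgroup {p. free_eval g p = 0} (add_monoid free_algebra)"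
    proof
      fix p assume "p \<in> {p. free_eval g p = 0}"
      then show "inv\<^bsub>add_monoid free_algebra\<^esub> p \<in> {p. free_eval g p = 0}"
        using free_eval_diff[of g 0 p] by (simp add: inv)
    qed (simp_all add: free_algebra_def free_eval_add)
  qed (simp_all add: free_algebra_def free_eval_mult)
qed

section \<open>The defining ideal as the kernel of the representation\<close>

context
  fixes f :: "complex poly"
begin

interpretation I: ideal "heis_ideal f" free_algebra
  by (rule ideal_heis_ideal)

lemma relators_in_ideal: "heis_relators f \<subseteq> heis_ideal f"
  unfolding heis_ideal_def by (rule I.genideal_self) (simp add: free_algebra_def)

interpretation rel: heis_relations "Poly_Mapping.single 0" "heis_ideal f" "free_gen GX" "free_gen GY" "free_gen GH" f
proof
  fix u v
  show "0 \<in> heis_ideal f"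
    using I.additive_subgroup_axioms additive_subgroup.zero_closed by (fastforce simp: free_algebra_def)
  show "u + v \<in> heis_ideal f" if "u \<in> heis_ideal f" "v \<in> heis_ideal f"
    using additive_subgroup.a_closed[OF I.additive_subgroup_axioms that] by (simp add: free_algebra_def)
  show "v * u \<in> heis_ideal f" if "u \<in> heis_ideal f"
    using I.I_l_closed[OF that, of v] by (simp add: free_algebra_def)
  show "u * v \<in> heis_ideal f" if "u \<in> heis_ideal f"
    using I.I_r_closed[OF that, of v] by (simp add: free_algebra_def)
qed (use relators_in_ideal in \<open>simp_all add: heis_relators_def Let_def poly_in_h_eq_peval\<close>)

lemma has_nf_free_alg: "rel.has_nf p"
proof (induction p rule: poly_mapping_single_induct)
  case (1 w c)
  obtain ws where w: "w = FM ws"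
    by (cases w)
  have "rel.has_nf (Poly_Mapping.single (FM ws) 1)"
  proof (induction ws)
    case Nil
    have "Poly_Mapping.single (FM []) 1 = free.nf_word (free_gen GX) (free_gen GH) (free_gen GY) (0, 0) 1"
      by (simp add: free.nf_word_def flip: zero_free_monoid_def)
    then show ?case
      by (simp only: rel.has_nf_word)
  next
    case (Cons a ws)
    have "Poly_Mapping.single (FM (a # ws)) 1 = free_gen a * Poly_Mapping.single (FM ws) (1 :: complex)"
      by (simp add: free_gen_def mult_single plus_free_monoid_def)
    then show ?case
      using Cons rel.has_nf_x rel.has_nf_y rel.has_nf_h by (cases a) simp_all
  qed
  moreover have "Poly_Mapping.single w c = Poly_Mapping.single 0 c * Poly_Mapping.single (FM ws) 1"
    by (simp add: w mult_single)
  ultimately show ?case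
    by (simp only: rel.has_nf_sc)
qed (rule rel.has_nf_add)

definition model_eval :: "heis_gen free_alg \<Rightarrow> complex poly lin_endo" where
  "model_eval = endo.free_eval (case_heis_gen model_x (model_y f) (model_h f))"

lemma model_eval_hom:
  "model_eval (p + q) = model_eval p + model_eval q"
  "model_eval (p - q) = model_eval p - model_eval q"
  "model_eval (p * q) = model_eval p * model_eval q"
  "model_eval (Poly_Mapping.single 0 c) = endo_sc c"
  "model_eval 0 = 0"
  "model_eval (sum r A) = (\<Sum>i\<in>A. model_eval (r i))"
  by (simp_all add: model_eval_def endo.free_eval_add endo.free_eval_diff endo.free_eval_mult
      endo.free_eval_sum)

lemma model_eval_gen [simp]:
  "model_eval (free_gen GX) = model_x" "model_eval (free_gen GY) = model_y f"
  "model_eval (free_gen GH) = model_h f"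
  by (simp_all add: model_eval_def)

lemma model_eval_ideal:
  assumes "p \<in> heis_ideal f"
  shows "model_eval p = 0"
proof -
  have "heis_ideal f \<subseteq> {p. model_eval p = 0}"
    unfolding heis_ideal_def
  proof (rule I.genideal_minimal)
    show "ideal {p. model_eval p = 0} free_algebra"
      unfolding model_eval_def by (rule endo.ideal_ker_free_eval)
    have "model_eval (poly_in_h f) = endo.peval f (model_h f)"
      by (simp add: poly_in_h_eq_peval model_eval_def endo.free_eval_peval)
    then show "heis_relators f \<subseteq> {p. model_eval p = 0}"
      using model_hx[of f] model_yh[of f] model_yx[of f]
      by (simp add: heis_relators_def Let_def model_eval_hom)
  qed
  with assms show ?thesis by blast
qed

lemma model_eval_has_nf: "\<exists>P. model_eval p = endo.nf model_x (model_h f) (model_y f) P \<and>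
    p - free.nf (free_gen GX) (free_gen GH) (free_gen GY) P \<in> heis_ideal f"
proof -
  obtain P where P: "p - free.nf (free_gen GX) (free_gen GH) (free_gen GY) P \<in> heis_ideal f"
    using has_nf_free_alg[of p] unfolding rel.has_nf_def by blast
  have "model_eval (free.nf (free_gen GX) (free_gen GH) (free_gen GY) P) =
      endo.nf model_x (model_h f) (model_y f) P"
    by (simp add: model_eval_def endo.free_eval_nf)
  with model_eval_ideal[OF P] P show ?thesis
    by (auto simp: model_eval_hom)
qed

text \<open>Faithfulness: modulo the ideal \<open>p\<close> is a normal form, and a normal form that
  acts as zero has no coefficients.\<close>

lemma model_eval_eq_0_iff:
  assumes "degree f > 1"
  shows "model_eval p = 0 \<longleftrightarrow> p \<in> heis_ideal f"
proof
  assume "model_eval p = 0"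
  moreover obtain P where P: "model_eval p = endo.nf model_x (model_h f) (model_y f) P"
      "p - free.nf (free_gen GX) (free_gen GH) (free_gen GY) P \<in> heis_ideal f"
    using model_eval_has_nf by blast
  ultimately have "P = 0"
    using nf_eq_0_iff[OF assms] by simp
  with P show "p \<in> heis_ideal f" by simp
qed (rule model_eval_ideal)

definition coset :: "heis_gen free_alg \<Rightarrow> heis_gen free_alg set" where
  "coset p = heis_ideal f +>\<^bsub>free_algebra\<^esub> p"

lemma coset_eq_iff:
  assumes "degree f > 1"
  shows "coset p = coset q \<longleftrightarrow> model_eval p = model_eval q"
proof -
  have "\<ominus>\<^bsub>free_algebra\<^esub> q = - q" for q :: "heis_gen free_alg"
    using I.minus_equality[of "- q" q] by (simp add: free_algebra_def)
  then have "p \<ominus>\<^bsub>free_algebra\<^esub> q = p - q"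
    by (simp add: a_minus_def) (simp add: free_algebra_def)
  moreover have "p \<ominus>\<^bsub>free_algebra\<^esub> q \<in> heis_ideal f \<longleftrightarrow> coset p = coset q"
    unfolding coset_def by (rule I.quotient_eq_iff_same_a_r_cos[OF ideal_heis_ideal]) (simp_all add: free_algebra_def)
  ultimately show ?thesis
    using model_eval_eq_0_iff[OF assms, of "p - q"] by (simp add: model_eval_hom)
qed

lemma carrier_gen_heisenberg: "carrier (gen_heisenberg f) = range coset"
proof -
  have "carrier (gen_heisenberg f) = (\<Union>p\<in>carrier free_algebra. {coset p})"
    by (simp add: gen_heisenberg_def quotient_algebra_def FactRing_simps coset_def)
  moreover have "carrier free_algebra = UNIV"
    by (simp add: free_algebra_def)
  ultimately show ?thesis
    by auto
qed

lemma coset_add: "coset p \<oplus>\<^bsub>gen_heisenberg f\<^esub> coset q = coset (p + q)"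
  using I.a_rcos_sum[of p q]
  by (simp add: gen_heisenberg_def quotient_algebra_def FactRing_def coset_def free_algebra_def)

lemma coset_mult: "coset p \<otimes>\<^bsub>gen_heisenberg f\<^esub> coset q = coset (p * q)"
  using I.rcoset_mult_add[of p q]
  by (simp add: gen_heisenberg_def quotient_algebra_def FactRing_def coset_def free_algebra_def)

lemma coset_smult: "c \<odot>\<^bsub>gen_heisenberg f\<^esub> coset p = coset (Poly_Mapping.single 0 c * p)"
  unfolding gen_heisenberg_def coset_def by (rule quotient_algebra_smult[OF ideal_heis_ideal])

lemma coset_0: "\<zero>\<^bsub>gen_heisenberg f\<^esub> = coset 0"
  using I.a_rcos_zero[OF ideal_heis_ideal additive_subgroup.zero_closed[OF I.additive_subgroup_axioms]]
  by (simp add: gen_heisenberg_def quotient_algebra_def FactRing_def coset_def free_algebra_def)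

end

section \<open>Transport of the derivation\<close>

text \<open>The relation is indexed by exponents and not by vectors, as it will become a polynomial
  in \<delta>. For injective \<open>g\<close> it comes from an infinite subset of a
  finite-dimensional space; otherwise a repetition g i = g j is itself a relation.\<close>

lemma (in vectorspace) fin_dim_span_dependent:
  assumes g: "\<And>k :: nat. g k \<in> carrier V"
    and fd: "vectorspace.fin_dim K (V\<lparr>carrier := span (range g)\<rparr>)"
  obtains A c k where "finite A" "c \<in> A \<rightarrow> carrier K" "k \<in> A" "c k \<noteq> \<zero>\<^bsub>K\<^esub>"
    "(\<Oplus>\<^bsub>V\<^esub>i\<in>A. c i \<odot>\<^bsub>V\<^esub> g i) = \<zero>\<^bsub>V\<^esub>"
proof (cases "inj g")
  case True
  let ?W = "span (range g)"
  have sub: "range g \<subseteq> carrier V"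
    using g by blast
  have W: "LinearCombinations.submodule K ?W V"
    by (rule span_is_submodule[OF sub])
  interpret W: vectorspace K "V\<lparr>carrier := ?W\<rparr>"
    by (rule vectorspace.intro[OF submodule_is_module[OF W]]) unfold_locales
  have in_W: "range g \<subseteq> ?W"
    by (rule in_own_span[OF sub])
  have "infinite (range g)"
    using True by (simp add: finite_image_iff)
  then have "W.lin_dep (range g)"
    using W.fin_dim_li_fin[OF fd] in_W by auto
  then have "lin_dep (range g)"
    using span_li_not_depend(2)[OF in_W W] by simp
  then obtain B a v where B: "finite B" "B \<subseteq> range g" "a \<in> B \<rightarrow> carrier K" "lincomb a B = \<zero>\<^bsub>V\<^esub>"
      "v \<in> B" "a v \<noteq> \<zero>\<^bsub>K\<^esub>"
    unfolding lin_dep_def by blast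
  obtain k where k: "v = g k"
    using B by blast
  define A where "A = g -` B"
  have A: "B = g ` A" "finite A" "inj_on g A"
    using B True by (auto simp: A_def finite_vimageI inj_on_def)
  have sum: "(\<Oplus>\<^bsub>V\<^esub>i\<in>A. a (g i) \<odot>\<^bsub>V\<^esub> g i) = lincomb a B"
    unfolding lincomb_def A(1) using A(3) B g
    by (subst finsum_reindex) (auto simp: A(1) Pi_iff)
  show ?thesis
  proof (rule that)
    show "finite A" by (rule A)
    show "(\<lambda>i. a (g i)) \<in> A \<rightarrow> carrier K" "k \<in> A" "a (g k) \<noteq> \<zero>\<^bsub>K\<^esub>"
      using B k by (auto simp: A_def)
    show "(\<Oplus>\<^bsub>V\<^esub>i\<in>A. a (g i) \<odot>\<^bsub>V\<^esub> g i) = \<zero>\<^bsub>V\<^esub>"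
      using sum B(4) by simp
  qed
next
  case False
  then obtain i j where ij: "i \<noteq> j" "g i = g j"
    by (auto simp: inj_def)
  have "(\<Oplus>\<^bsub>V\<^esub>k\<in>{i, j}. (if k = i then \<one>\<^bsub>K\<^esub> else \<ominus>\<^bsub>K\<^esub> \<one>\<^bsub>K\<^esub>) \<odot>\<^bsub>V\<^esub> g k) =
      \<one>\<^bsub>K\<^esub> \<odot>\<^bsub>V\<^esub> g i \<oplus>\<^bsub>V\<^esub> (\<ominus>\<^bsub>K\<^esub> \<one>\<^bsub>K\<^esub>) \<odot>\<^bsub>V\<^esub> g i"
    using ij g[of i] g[of j] by (subst finsum_insert) auto
  also have "\<dots> = \<zero>\<^bsub>V\<^esub>"
    using g[of i] by (simp add: smult_l_minus M.r_neg)
  finally show ?thesis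
    by (rule that[of "{i, j}" _ i, rotated 4]) auto
qed

locale lf_derivation_gen_heisenberg =
  fixes f :: "complex poly" and \<delta> :: "heis_gen free_alg set \<Rightarrow> heis_gen free_alg set"
  assumes degree_f: "degree f > 1"
    and derivation: "derivation (gen_heisenberg f) \<delta>"
    and locally_finite: "locally_finite (gen_heisenberg f) \<delta>"
begin

abbreviation "\<pi> \<equiv> coset f"
abbreviation "ev \<equiv> model_eval f"

lemma \<delta>_hom: "\<delta> \<in> LinearCombinations.module_hom class_ring (gen_heisenberg f) (gen_heisenberg f)"
  using derivation by (simp add: derivation_def)

lemma \<delta>_coset: "\<exists>q. \<delta> (\<pi> p) = \<pi> q"
proof -
  have "\<delta> \<in> carrier (gen_heisenberg f) \<rightarrow> carrier (gen_heisenberg f)"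
    by (rule LinearCombinations.module_hom_closed[OF \<delta>_hom])
  then show ?thesis
    by (auto simp: carrier_gen_heisenberg Pi_iff)
qed

text \<open>A choice of representatives; only the coset of \<open>lift p\<close> is determined by
  \<delta>.\<close>

definition lift :: "heis_gen free_alg \<Rightarrow> heis_gen free_alg" where
  "lift p = (SOME q. \<delta> (\<pi> p) = \<pi> q)"

lemma \<delta>_coset_lift: "\<delta> (\<pi> p) = \<pi> (lift p)"
  unfolding lift_def by (rule someI_ex[OF \<delta>_coset])

text \<open>This transports \<delta> along the bijection between cosets and operators in the range
  of \<open>ev\<close>; outside that range the value is arbitrary.\<close>

definition model_\<delta> :: "complex poly lin_endo \<Rightarrow> complex poly lin_endo" where
  "model_\<delta> a = ev (lift (SOME p. ev p = a))"

lemma model_\<delta>_eval: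
  assumes "\<delta> (\<pi> p) = \<pi> q"
  shows "model_\<delta> (ev p) = ev q"
proof -
  let ?p = "SOME r. ev r = ev p"
  have "ev ?p = ev p"
    by (rule someI[of "\<lambda>r. ev r = ev p" p]) simp
  then have "\<pi> ?p = \<pi> p"
    by (simp add: coset_eq_iff[OF degree_f])
  then have "\<pi> (lift ?p) = \<pi> q"
    using \<delta>_coset_lift[of ?p] assms by simp
  then show ?thesis
    by (simp add: model_\<delta>_def coset_eq_iff[OF degree_f])
qed

lemma model_\<delta>_lift: "model_\<delta> (ev p) = ev (lift p)"
  by (rule model_\<delta>_eval[OF \<delta>_coset_lift])

lemma coset_carrier: "\<pi> p \<in> carrier (gen_heisenberg f)"
  by (simp add: carrier_gen_heisenberg)

lemma \<delta>_pow_coset: "(\<delta> ^^ k) (\<pi> p) = \<pi> ((lift ^^ k) p)"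
  by (induction k) (simp_all add: \<delta>_coset_lift)

lemma model_\<delta>_pow: "(model_\<delta> ^^ k) (ev p) = ev ((lift ^^ k) p)"
  by (induction k) (simp_all add: model_\<delta>_lift)

text \<open>The linear relation among the iterates is read as a polynomial with coefficient
  \<open>c i\<close> for i in \<open>A\<close> and 0 elsewhere, nonzero because of the exponent
  \<open>k\<close>.\<close>

lemma model_annihilated:
  obtains P where "P \<noteq> 0" "(\<Sum>i\<le>degree P. endo_sc (coeff P i) * (model_\<delta> ^^ i) (ev p)) = 0"
proof -
  interpret V: vectorspace class_ring "gen_heisenberg f"
    by (rule vectorspace_gen_heisenberg)
  let ?g = "\<lambda>k. (\<delta> ^^ k) (\<pi> p)"
  have g: "?g k \<in> carrier (gen_heisenberg f)" for k
    by (simp add: \<delta>_pow_coset coset_carrier)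
  have "{(\<delta> ^^ k) (\<pi> p) |k. True} = range ?g"
    by auto
  then have fd: "vectorspace.fin_dim class_ring (gen_heisenberg f\<lparr>carrier := V.span (range ?g)\<rparr>)"
    using locally_finite coset_carrier[of p] by (auto simp: locally_finite_def)
  obtain A c k where "finite A" "k \<in> A" "c k \<noteq> \<zero>\<^bsub>class_ring\<^esub>"
      and sum0: "(\<Oplus>\<^bsub>gen_heisenberg f\<^esub>i\<in>A. c i \<odot>\<^bsub>gen_heisenberg f\<^esub> ?g i) = \<zero>\<^bsub>gen_heisenberg f\<^esub>"
    by (rule V.fin_dim_span_dependent[of ?g, OF g fd])
  then have A: "finite A" "k \<in> A" "c k \<noteq> 0"
    by simp_all
  have "(\<Oplus>\<^bsub>gen_heisenberg f\<^esub>i\<in>A. c i \<odot>\<^bsub>gen_heisenberg f\<^esub> ?g i) =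
      \<pi> (\<Sum>i\<in>A. Poly_Mapping.single 0 (c i) * (lift ^^ i) p)"
    using \<open>finite A\<close>
  proof (induction A)
    case empty
    show ?case by (simp add: coset_0)
  next
    case (insert i A)
    then show ?case
      by (simp add: \<delta>_pow_coset coset_smult coset_add coset_carrier)
  qed
  with sum0 have "ev (\<Sum>i\<in>A. Poly_Mapping.single 0 (c i) * (lift ^^ i) p) = ev 0"
    by (simp add: coset_0 flip: coset_eq_iff[OF degree_f])
  then have sum: "(\<Sum>i\<in>A. endo_sc (c i) * (model_\<delta> ^^ i) (ev p)) = 0"
    by (simp add: model_eval_hom model_\<delta>_pow)
  define P where "P = (\<Sum>i\<in>A. monom (c i) i)"
  have coeff: "coeff P i = (if i \<in> A then c i else 0)" for i
    using \<open>finite A\<close> by (simp add: P_def coeff_sum)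
  show ?thesis
  proof (rule that)
    show "P \<noteq> 0"
      using A coeff[of k] by auto
    have "(\<Sum>i\<le>degree P. endo_sc (coeff P i) * (model_\<delta> ^^ i) (ev p)) =
        (\<Sum>i\<in>A. endo_sc (c i) * (model_\<delta> ^^ i) (ev p))"
    proof (rule sum.mono_neutral_cong)
      show "endo_sc (c i) * (model_\<delta> ^^ i) (ev p) = 0" if "i \<in> A - {..degree P}" for i
        using that coeff[of i] coeff_eq_0[of P i] by simp
    qed (use \<open>finite A\<close> coeff in auto)
    with sum show "(\<Sum>i\<le>degree P. endo_sc (coeff P i) * (model_\<delta> ^^ i) (ev p)) = 0"
      by simp
  qed
qed

sublocale model: subalgebra endo_sc "range ev"
proof
  show "endo_sc c \<in> range ev" for c
    by (rule range_eqI[of _ _ "Poly_Mapping.single 0 c"]) (simp add: model_eval_hom)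
  show "a + b \<in> range ev" if "a \<in> range ev" "b \<in> range ev" for a b
    using that by (auto intro!: range_eqI[where f = ev, OF model_eval_hom(1)[symmetric]])
  show "a * b \<in> range ev" if "a \<in> range ev" "b \<in> range ev" for a b
    using that by (auto intro!: range_eqI[where f = ev, OF model_eval_hom(3)[symmetric]])
qed

lemma model_\<delta>_add: "model_\<delta> (ev p + ev q) = model_\<delta> (ev p) + model_\<delta> (ev q)"
proof -
  have "\<delta> (\<pi> p \<oplus>\<^bsub>gen_heisenberg f\<^esub> \<pi> q) = \<delta> (\<pi> p) \<oplus>\<^bsub>gen_heisenberg f\<^esub> \<delta> (\<pi> q)"
    by (rule LinearCombinations.module_hom_add[OF \<delta>_hom coset_carrier coset_carrier])
  then have "\<delta> (\<pi> (p + q)) = \<pi> (lift p + lift q)"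
    by (simp add: coset_add \<delta>_coset_lift)
  from model_\<delta>_eval[OF this] show ?thesis
    by (simp add: model_eval_hom model_\<delta>_lift)
qed

lemma model_\<delta>_scale: "model_\<delta> (endo_sc c * ev p) = endo_sc c * model_\<delta> (ev p)"
proof -
  have "\<delta> (c \<odot>\<^bsub>gen_heisenberg f\<^esub> \<pi> p) = c \<odot>\<^bsub>gen_heisenberg f\<^esub> \<delta> (\<pi> p)"
    by (rule LinearCombinations.module_hom_smult[OF \<delta>_hom _ coset_carrier]) simp
  then have "\<delta> (\<pi> (Poly_Mapping.single 0 c * p)) = \<pi> (Poly_Mapping.single 0 c * lift p)"
    by (simp add: coset_smult \<delta>_coset_lift)
  from model_\<delta>_eval[OF this] show ?thesis
    by (simp add: model_eval_hom model_\<delta>_lift)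
qed

lemma model_\<delta>_mult: "model_\<delta> (ev p * ev q) = model_\<delta> (ev p) * ev q + ev p * model_\<delta> (ev q)"
proof -
  have "\<delta> (\<pi> p \<otimes>\<^bsub>gen_heisenberg f\<^esub> \<pi> q) =
      \<delta> (\<pi> p) \<otimes>\<^bsub>gen_heisenberg f\<^esub> \<pi> q \<oplus>\<^bsub>gen_heisenberg f\<^esub> \<pi> p \<otimes>\<^bsub>gen_heisenberg f\<^esub> \<delta> (\<pi> q)"
    using derivation coset_carrier by (simp add: derivation_def)
  then have "\<delta> (\<pi> (p * q)) = \<pi> (lift p * q + p * lift q)"
    by (simp add: coset_add coset_mult \<delta>_coset_lift)
  from model_\<delta>_eval[OF this] show ?thesis
    by (simp add: model_eval_hom model_\<delta>_lift)
qed

sublocale model: model_derivation "range ev" model_\<delta> f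
proof
  show "a = 0 \<or> b = 0" if ab: "a \<in> range ev" "b \<in> range ev" "a * b = 0" for a b
  proof -
    obtain P Q where "a = endo.nf model_x (model_h f) (model_y f) P"
        "b = endo.nf model_x (model_h f) (model_y f) Q"
      using ab model_eval_has_nf[of f] by blast
    then show ?thesis
      using ab(3) nf_mult_nonzero[OF degree_f, of P Q] by (auto simp: nf_eq_0_iff[OF degree_f])
  qed
  show "\<exists>ls. fold (\<lambda>l b. model_\<delta> b - endo_sc l * b) ls a = 0" if a: "a \<in> range ev" for a
  proof -
    obtain p where p: "a = ev p"
      using a by blast
    obtain P where "P \<noteq> 0" "(\<Sum>i\<le>degree P. endo_sc (coeff P i) * (model_\<delta> ^^ i) (ev p)) = 0"
      by (rule model_annihilated)
    then show ?thesis
      unfolding p by (intro model.poly_annihilated_factor)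
        (auto simp: model_\<delta>_lift model_\<delta>_add model_\<delta>_scale)
  qed
  show "\<exists>P. a = endo.nf model_x (model_h f) (model_y f) P" if "a \<in> range ev" for a
    using that model_eval_has_nf[of f] by blast
  show "model_x \<in> range ev" "model_h f \<in> range ev" "model_y f \<in> range ev"
    using model_eval_gen[of f] by (metis rangeI)+
  show "degree f > 1"
    by (rule degree_f)
qed (auto simp: model_\<delta>_lift model_\<delta>_add model_\<delta>_scale model_\<delta>_mult)

lemma \<delta>_coset_eqI: "model_\<delta> (ev p) = ev q \<Longrightarrow> \<delta> (\<pi> p) = \<pi> q"
  by (simp add: model_\<delta>_lift \<delta>_coset_lift coset_eq_iff[OF degree_f])

end

theorem theorem4p3:
  fixes f :: "complex poly"
    and \<delta> :: "heis_gen free_alg set \<Rightarrow> heis_gen free_alg set"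
  assumes "degree f > 1"
    and "derivation (gen_heisenberg f) \<delta>"
    and "locally_finite (gen_heisenberg f) \<delta>"
  shows "\<exists>l::complex. \<delta> (heis_x f) = l \<odot>\<^bsub>gen_heisenberg f\<^esub> heis_x f \<and>
    \<delta> (heis_y f) = (- l) \<odot>\<^bsub>gen_heisenberg f\<^esub> heis_y f \<and>
    \<delta> (heis_h f) = \<zero>\<^bsub>gen_heisenberg f\<^esub>"
proof -
  interpret lf_derivation_gen_heisenberg f \<delta>
    using assms by unfold_locales
  obtain l where l: "model_\<delta> model_x = endo_sc l * model_x" "model_\<delta> (model_y f) = - (endo_sc l * model_y f)"
      "model_\<delta> (model_h f) = 0"
    by (rule model.\<delta>_scaling)
  \<comment> \<open>The scaling found for operators is pulled back to cosets by
    faithfulness.\<close>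
  have "\<delta> (\<pi> (free_gen GX)) = \<pi> (Poly_Mapping.single 0 l * free_gen GX)"
    "\<delta> (\<pi> (free_gen GY)) = \<pi> (Poly_Mapping.single 0 (- l) * free_gen GY)"
    "\<delta> (\<pi> (free_gen GH)) = \<pi> 0"
    by (rule \<delta>_coset_eqI; simp add: l model_eval_hom endo.sc_minus)+
  then show ?thesis
    by (intro exI[of _ l]) (simp add: heis_x_def heis_y_def heis_h_def coset_smult coset_0 flip: coset_def)
qed

end
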